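(* Let $p_1,p_2$ be two distinct primes, let $\delta\in\{0,1\}$, and let $m,a,b,c$ be positive integers with $m>2$. In any finite abelian group $G$ of the relevant order: (1) Let $q_1,\dots,q_t$ be $t$ distinct primes with $q_i\mid (m-1)p_1^{2a+\delta}+1$ for $i=1,\dots,t$. If $p_1$ is self-conjugate modulo $q_1\cdots q_t$ and $q_1\cdots q_t>2^{t-1}\big((m-1)p_1^{2a-b}+p_1^{-b}\big)$, then a $\big((m-1)p_1^{2a+\delta}+1,\ m,\ p_1^{a+b+\delta},\ p_1^{2b+\delta}\big)$-SEDF does not exist. (2) Let $q_1,\dots,q_t$ be $t$ distinct primes with $q_i\mid (m-1)p_1^{2a+\delta}p_2^{2c}+1$ for $i=1,\dots,t$. If $p_1$ is self-conjugate modulo $q_1\cdots q_t$ and $q_1\cdots q_t>2^{t-1}\big((m-1)p_1^{2a-b}p_2^{2c}+p_1^{-b}\big)$, then a $\big((m-1)p_1^{2a+\delta}p_2^{2c}+1,\ m,\ p_1^{a+b+\delta}p_2^{c},\ p_1^{2b+\delta}\big)$-SEDF does not exist. (3) Let $q_1,\dots,q_t$ be $t$ distinct primes with $q_i\mid (m-1)p_1^{2a}+1$ for $i=1,\dots,t$. If $p_2$ is self-conjugate modulo $q_1\cdots q_t$ and $q_1\cdots q_t\, p_2^{b}>2^{t-1}\big((m-1)p_1^{2a}+1\big)$, then a $\big((m-1)p_1^{2a}+1,\ m,\ p_1^{a}p_2^{b},\ p_2^{2b}\big)$-SEDF does not exist.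
   Context: Let $G$ be a finite abelian group of order $v$ (written multiplicatively) with identity $e$. For positive integers $m,k,\lambda$, a $(v,m,k,\lambda)$-SEDF in $G$ is a collection $\{D_1,\dots,D_m\}$ of pairwise disjoint $k$-subsets of $G$ such that for each $j$ the multiset $\{xy^{-1}: x\in D_\ell,\ y\in D_j,\ \ell\neq j\}$ contains every non-identity element of $G$ exactly $\lambda$ times and does not contain $e$. Self-conjugacy: for a prime $p$ and positive integer $w$, write $w=p^s u$ with $\gcd(u,p)=1$; $p$ is self-conjugate modulo $w$ if there is an integer $r$ with $p^r\equiv -1\pmod u$. *)

theory Defs
  imports
    "HOL-Analysis.Analysis"
    "HOL-Number_Theory.Number_Theory"
    "HOL-Algebra.Coset"
begin

(* Taking r :: nat loses nothing: p is a unit modulo u, hence of finite order, so any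
   negative exponent can be replaced by a nonnegative one. *)
definition self_conjugate_modulo :: "nat \<Rightarrow> nat \<Rightarrow> bool" where
  "self_conjugate_modulo p w \<longleftrightarrow>
     (\<exists>s u r :: nat. w = p ^ s * u \<and> coprime u p \<and> [int p ^ r = - 1] (mod int u))"

definition external_differences ::
    "('a, 'b) monoid_scheme \<Rightarrow> nat \<Rightarrow> (nat \<Rightarrow> 'a set) \<Rightarrow> nat \<Rightarrow> 'a multiset" where
  "external_differences G m D j =
     (\<Sum>l\<in>{1..m} - {j}.
        image_mset (\<lambda>(x, y). x \<otimes>\<^bsub>G\<^esub> inv\<^bsub>G\<^esub> y) (mset_set (D l \<times> D j)))"

(* Only the values D 1, ..., D m of the function D matter. *)
definition is_SEDF ::
    "('a, 'b) monoid_scheme \<Rightarrow> nat \<Rightarrow> nat \<Rightarrow> nat \<Rightarrow> nat \<Rightarrow> (nat \<Rightarrow> 'a set) \<Rightarrow> bool" where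
  "is_SEDF G v m k lam D \<longleftrightarrow>
     comm_group G \<and> finite (carrier G) \<and> Coset.order G = v \<and>
     0 < m \<and> 0 < k \<and> 0 < lam \<and>
     (\<forall>j\<in>{1..m}. D j \<subseteq> carrier G \<and> card (D j) = k) \<and>
     disjoint_family_on D {1..m} \<and>
     (\<forall>j\<in>{1..m}.
        (\<forall>g\<in>carrier G - {\<one>\<^bsub>G\<^esub>}. count (external_differences G m D j) g = lam) \<and>
        \<one>\<^bsub>G\<^esub> \<notin># external_differences G m D j)"

end

(*
Choose a surjection of G onto the cyclic group of order w = q_1 ... q_t and let X_j be the sum of the
resulting character over D_j.  The SEDF property says (S - X_j) cnj X_j = - lam with S = sum_j X_j;
for m > 2 this forces some |X_j|^2 to be a power p^n with p^n >= lam.  Since p is self-conjugate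
modulo w, an element x of Z[zeta_w] with x cnj x = p^n is divisible by p^(n div 2), so X_j is divisible
by a large power p^B.  Expressing X_j through the numbers of elements of D_j in the fibres of G -> Z/w,
which are at most v / w, the iterated differences of these numbers along the steps w / q_i are divisible
by p^B and bounded by 2^(t-1) v / w < p^B.  So they vanish, which gives X_j = 0, a contradiction.
*)
theory Submission
  imports Defs "HOL-Algebra.Sylow" "HOL-Computational_Algebra.Squarefree" "Jordan_Normal_Form.Char_Poly"
begin

section \<open>Integrality in rings generated by a root of unity\<close>

text \<open>Prime ideals of Z[zeta_w] are avoided. Divisibility by p rests on two facts: elements of
  Z[z] are algebraic integers, so Z[z] meets Q only in Z; and f(z)^p is congruent to f(z^p) modulo p
  for integer polynomials f. One obstacle is that p may divide w. As w is squarefree, it does so at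
  most once; then p is replaced by 1 - z^u with w = p * u, whose (p-1)-th power and p divide each
  other. When p does not divide w, the norm exponent n is moreover even, which gains the factor
  p^\<delta> in the odd case lam = p^(2b+1). The other obstacle is that the powers of z are linearly
  dependent over Q: a sum divisible by p^B need not have coefficients divisible by p^B. The
  differences along the steps w / q_i annihilate precisely the relations among these powers, while
  they multiply the character sum only by the nonzero numbers 1 - z^(w/q_i). The constant is 2^(t-1)
  and not 2^t because the first difference of counts between 0 and v / w is still at most v / w in
  absolute value.\<close>

definition int_adjoin :: "complex \<Rightarrow> complex set" where
  "int_adjoin z = range (\<lambda>f :: int poly. poly (of_int_poly f) z)"

lemma int_adjoin_poly [simp, intro]: "poly (of_int_poly f) z \<in> int_adjoin z"
  by (auto simp: int_adjoin_def)

lemma int_adjoinE: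
  assumes "x \<in> int_adjoin z"
  obtains f :: "int poly" where "x = poly (of_int_poly f) z"
  using assms by (auto simp: int_adjoin_def)

lemma int_adjoin_add [intro]: "x \<in> int_adjoin z \<Longrightarrow> y \<in> int_adjoin z \<Longrightarrow> x + y \<in> int_adjoin z"
  by (elim int_adjoinE) (metis int_adjoin_poly of_int_hom.map_poly_hom_add poly_add)

lemma int_adjoin_mult [intro]: "x \<in> int_adjoin z \<Longrightarrow> y \<in> int_adjoin z \<Longrightarrow> x * y \<in> int_adjoin z"
  by (elim int_adjoinE) (metis int_adjoin_poly of_int_poly_hom.hom_mult poly_mult)

lemma int_adjoin_uminus [intro]: "x \<in> int_adjoin z \<Longrightarrow> - x \<in> int_adjoin z"
  by (elim int_adjoinE) (metis int_adjoin_poly of_int_poly_hom.hom_uminus poly_minus)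

lemma int_adjoin_diff [intro]: "x \<in> int_adjoin z \<Longrightarrow> y \<in> int_adjoin z \<Longrightarrow> x - y \<in> int_adjoin z"
  using int_adjoin_add[of x z "- y"] by auto

lemma int_adjoin_of_int [simp, intro]: "of_int n \<in> int_adjoin z"
proof -
  have "poly (of_int_poly [:n:]) z = of_int n" by (simp add: of_int_hom.map_poly_pCons_hom)
  then show ?thesis by (metis int_adjoin_poly)
qed

lemma int_adjoin_of_nat [simp, intro]: "of_nat n \<in> int_adjoin z"
  using int_adjoin_of_int[of "int n" z] by simp

lemma int_adjoin_0_1 [simp, intro]: "0 \<in> int_adjoin z" "1 \<in> int_adjoin z"
  using int_adjoin_of_int[of 0 z] int_adjoin_of_int[of 1 z] by simp_all

lemma int_adjoin_self [simp, intro]: "z \<in> int_adjoin z"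
  using int_adjoin_poly[of "[:0, 1:]" z] by simp

lemma int_adjoin_power [intro]: "x \<in> int_adjoin z \<Longrightarrow> x ^ n \<in> int_adjoin z"
  by (induction n) auto

lemma int_adjoin_sum [intro]: "(\<And>i. i \<in> I \<Longrightarrow> f i \<in> int_adjoin z) \<Longrightarrow> sum f I \<in> int_adjoin z"
  by (induction I rule: infinite_finite_induct) auto

lemma int_adjoin_prod [intro]: "(\<And>i. i \<in> I \<Longrightarrow> f i \<in> int_adjoin z) \<Longrightarrow> prod f I \<in> int_adjoin z"
  by (induction I rule: infinite_finite_induct) auto

lemma int_adjoin_subset: "y \<in> int_adjoin z \<Longrightarrow> x \<in> int_adjoin y \<Longrightarrow> x \<in> int_adjoin z"
proof -
  assume y: "y \<in> int_adjoin z"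
  have "poly (of_int_poly f) y \<in> int_adjoin z" for f
    by (induction f) (use y in \<open>auto simp: of_int_hom.map_poly_pCons_hom\<close>)
  moreover assume "x \<in> int_adjoin y"
  ultimately show ?thesis by (auto elim: int_adjoinE)
qed

text \<open>The coefficients of the remainder of \<open>f\<close> modulo X^w - 1.\<close>

definition fold_coeff :: "nat \<Rightarrow> int poly \<Rightarrow> nat \<Rightarrow> int" where
  "fold_coeff w f k = (\<Sum>i | i \<le> degree f \<and> i mod w = k mod w. Polynomial.coeff f i)"

lemma sum_fold_coeff:
  assumes "z ^ w = 1" "w > 0"
  shows "(\<Sum>k<w. of_int (fold_coeff w f k) * z ^ k) = poly (of_int_poly f) (z :: complex)"
proof -
  have zmod: "z ^ (i mod w) = z ^ i" for i
    by (metis assms(1) div_mult_mod_eq lambda_one mult.commute power_add power_mult power_one)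
  have "poly (of_int_poly f) z = (\<Sum>i\<le>degree f. of_int (Polynomial.coeff f i) * z ^ i)"
    by (simp add: poly_altdef)
  also have "\<dots> = (\<Sum>k<w. \<Sum>i | i \<in> {..degree f} \<and> i mod w = k. of_int (Polynomial.coeff f i) * z ^ i)"
    by (rule sum.group[symmetric]) (use assms in auto)
  also have "\<dots> = (\<Sum>k<w. of_int (fold_coeff w f k) * z ^ k)"
  proof (rule sum.cong)
    fix k assume "k \<in> {..<w}"
    then have k: "k mod w = k" by simp
    have "(\<Sum>i | i \<in> {..degree f} \<and> i mod w = k. of_int (Polynomial.coeff f i) * z ^ i)
        = (\<Sum>i | i \<le> degree f \<and> i mod w = k mod w. of_int (Polynomial.coeff f i) * z ^ k)"
    proof (rule sum.cong)
      fix i assume "i \<in> {i. i \<le> degree f \<and> i mod w = k mod w}"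
      then have "z ^ i = z ^ k" using zmod[of i] zmod[of k] by simp
      then show "of_int (Polynomial.coeff f i) * z ^ i = of_int (Polynomial.coeff f i) * z ^ k" by simp
    qed (simp add: k)
    then show "(\<Sum>i | i \<in> {..degree f} \<and> i mod w = k. of_int (Polynomial.coeff f i) * z ^ i) = of_int (fold_coeff w f k) * z ^ k"
      by (simp add: fold_coeff_def sum_distrib_right)
  qed simp
  finally show ?thesis ..
qed

text \<open>Multiplication by \<open>x\<close> acts on the generators \<open>1, z, \<dots>\<close> of \<open>\<int>[z]\<close> by an integer matrix, whose
  characteristic polynomial annihilates \<open>x\<close>.\<close>
lemma int_adjoin_root_of_unity_integral:
  assumes z: "z ^ w = 1" "w > 0" and x: "x \<in> int_adjoin z"
  obtains f :: "int poly" where "lead_coeff f = 1" "poly (of_int_poly f) x = 0"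
proof -
  obtain g where g: "x = poly (of_int_poly g) z" using x by (rule int_adjoinE)
  define M :: "int mat" where "M = Matrix.mat w w (\<lambda>(i, j). fold_coeff w (Polynomial.monom 1 i * g) j)"
  define v where "v = Matrix.vec w (\<lambda>i. z ^ i)"
  have M: "M \<in> carrier_mat w w" by (simp add: M_def)
  let ?M = "map_mat complex_of_int M"
  have M': "?M \<in> carrier_mat w w" using M by simp
  have "?M *\<^sub>v v = x \<cdot>\<^sub>v v"
  proof (rule eq_vecI)
    fix i assume "i < dim_vec (x \<cdot>\<^sub>v v)"
    then have i: "i < w" by (simp add: v_def)
    have "(?M *\<^sub>v v) $ i = (\<Sum>k<w. of_int (fold_coeff w (Polynomial.monom 1 i * g) k) * z ^ k)"
      using i M by (auto simp: M_def v_def scalar_prod_def lessThan_atLeast0)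
    also have "\<dots> = z ^ i * x"
      using z by (simp add: sum_fold_coeff g of_int_poly_hom.hom_mult poly_monom map_poly_monom)
    finally show "(?M *\<^sub>v v) $ i = (x \<cdot>\<^sub>v v) $ i" using i by (simp add: v_def)
  qed (simp add: M_def v_def)
  moreover have "v \<noteq> 0\<^sub>v w"
  proof
    assume "v = 0\<^sub>v w"
    then have "v $ 0 = 0" using z by simp
    then show False using z by (simp add: v_def)
  qed
  ultimately have "eigenvalue ?M x"
    unfolding eigenvalue_def eigenvector_def using M' by (auto simp: v_def intro!: exI[of _ v])
  then have "poly (char_poly ?M) x = 0" using eigenvalue_root_char_poly[OF M'] by simp
  then have "poly (of_int_poly (char_poly M)) x = 0" using of_int_hom.char_poly_hom[OF M] by metis
  moreover have "lead_coeff (char_poly M) = 1" using degree_monic_char_poly[OF M] by simp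
  ultimately show ?thesis using that by blast
qed

lemma int_adjoin_rational_is_int:
  assumes z: "z ^ w = 1" "w > 0" and x: "x \<in> int_adjoin z" "x \<in> \<rat>"
  shows "x \<in> \<int>"
proof -
  obtain f :: "int poly" where "lead_coeff f = 1" "poly (of_int_poly f) x = 0"
    using int_adjoin_root_of_unity_integral z x by metis
  then have "algebraic_int x" unfolding algebraic_int_altdef_ipoly by blast
  then show ?thesis using x(2) by (rule rational_algebraic_int_is_int)
qed

text \<open>The quotient is rational and integral, hence an integer. This is what prevents a prime
  from becoming invertible in Z[z].\<close>

lemma int_adjoin_dvd_imp_dvd:
  assumes z: "z ^ w = 1" "w > 0" and x: "x \<in> int_adjoin z" and eq: "of_int a = of_int n * x"
  shows "n dvd a"
proof (cases "n = 0")
  case False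
  then have "x = of_int a / of_int n" using eq by (simp add: field_simps)
  then have "x \<in> \<rat>" by simp
  then obtain k where "x = of_int k" using int_adjoin_rational_is_int[OF z x] by (auto elim: Ints_cases)
  then have "a = n * k" using eq by (metis of_int_eq_iff of_int_mult)
  then show ?thesis by simp
qed (use eq in auto)

text \<open>Take a monic integer polynomial with root x and strip factors X from it, which is
  possible as x is nonzero. The constant term that appears is then a nonzero multiple of x.\<close>

lemma int_adjoin_nonzero_dvd_int:
  assumes z: "z ^ w = 1" "w > 0" and x: "x \<in> int_adjoin z" "x \<noteq> 0"
  obtains n y where "n \<noteq> 0" "y \<in> int_adjoin z" "of_int n = x * y"
proof -
  obtain f :: "int poly" where f: "lead_coeff f = 1" "poly (of_int_poly f) x = 0"
    using int_adjoin_root_of_unity_integral z x by metis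
  have "\<exists>n y. n \<noteq> 0 \<and> y \<in> int_adjoin x \<and> of_int n = x * y"
    if "f \<noteq> 0" "poly (of_int_poly f) x = 0" for f :: "int poly"
    using that
  proof (induction f)
    case (pCons a f)
    let ?y = "poly (of_int_poly f) x"
    have eq: "of_int a + x * ?y = 0"
      using pCons.prems by (simp add: of_int_hom.map_poly_pCons_hom)
    show ?case
    proof (cases "a = 0")
      case True
      then show ?thesis using eq pCons x by auto
    next
      case False
      have "of_int a = x * (- ?y)" using eq by (simp add: eq_neg_iff_add_eq_0)
      with False show ?thesis by blast
    qed
  qed simp
  moreover have "f \<noteq> 0" using f(1) by auto
  ultimately show ?thesis using f(2) that x(1) int_adjoin_subset by metis
qed

section \<open>The Frobenius congruence modulo p, and Galois conjugates of a root of unity\<close>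

lemma prime_dvd_add_power_diff:
  fixes a b :: "'a :: comm_ring_1"
  assumes "Factorial_Ring.prime (p :: nat)"
  shows "of_nat p dvd (a + b) ^ p - (a ^ p + b ^ p)"
proof -
  have p: "p > 0" using assms prime_gt_0_nat by blast
  have "{..p} = insert 0 (insert p {0<..<p})" using p by auto
  then have "(a + b) ^ p = a ^ p + b ^ p + (\<Sum>k\<in>{0<..<p}. of_nat (p choose k) * a ^ k * b ^ (p - k))"
    using p by (simp add: binomial_ring)
  moreover have "of_nat p dvd (\<Sum>k\<in>{0<..<p}. of_nat (p choose k) * a ^ k * b ^ (p - k))"
  proof (rule dvd_sum)
    fix k assume "k \<in> {0<..<p}"
    then have "p dvd (p choose k)" using assms by (intro dvd_choose_prime) auto
    then have "(of_nat p :: 'a) dvd of_nat (p choose k)" by (metis dvd_def of_nat_mult)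
    then show "of_nat p dvd of_nat (p choose k) * a ^ k * b ^ (p - k)" by simp
  qed
  ultimately show ?thesis by (simp add: algebra_simps)
qed

text \<open>The congruence f^p = f(X^p) modulo p already holds in Z[X]. The induction follows
  Horner's form of f and uses Fermat's little theorem for the constant term.\<close>

lemma int_poly_frobenius:
  fixes z :: complex and f :: "int poly"
  assumes p: "Factorial_Ring.prime (p :: nat)"
  shows "\<exists>y\<in>int_adjoin z. poly (of_int_poly f) z ^ p - poly (of_int_poly f) (z ^ p) = of_nat p * y"
proof -
  have "\<exists>g. f ^ p - pcompose f (Polynomial.monom 1 p) = of_nat p * g"
  proof (induction f)
    case 0
    show ?case using p prime_gt_0_nat[of p] by (auto simp: power_0_left intro: exI[of _ 0])
  next
    case (pCons a f)
    then obtain g where g: "f ^ p - pcompose f (Polynomial.monom 1 p) = of_nat p * g" by blast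
    have eq: "pCons a f = [:a:] + Polynomial.monom 1 1 * f"
      by (simp add: monom_altdef)
    obtain h where h: "(pCons a f) ^ p - ([:a:] ^ p + (Polynomial.monom 1 1 * f) ^ p) = of_nat p * h"
      using prime_dvd_add_power_diff[OF p, of "[:a:]" "Polynomial.monom 1 1 * f"] eq by (auto elim: dvdE)
    have "[a ^ p = a] (mod int p)"
    proof -
      define n where "n = nat (a mod p)"
      have n: "int n = a mod p" using p prime_gt_0_nat by (simp add: n_def)
      have "[n ^ p = n] (mod p)"
      proof (cases "p dvd n")
        case True
        then have "p dvd n ^ p" using dvd_trans[of p n "n ^ p"] dvd_power[of p n] prime_gt_0_nat[OF p] by blast
        then show ?thesis using True by (simp add: cong_def dvd_imp_mod_0)
      next
        case False
        from fermat_theorem[OF p False]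
        have "[n ^ (p - 1) * n = 1 * n] (mod p)"
          by (rule cong_scalar_right)
        then show ?thesis
          using p prime_gt_0_nat[of p] by (simp flip: power_Suc2)
      qed
      then have "[int n ^ p = int n] (mod int p)" by (metis cong_int_iff of_nat_power)
      then show ?thesis unfolding n by (simp add: cong_def power_mod)
    qed
    then obtain k where k: "a ^ p - a = int p * k" by (auto simp: cong_iff_dvd_diff elim: dvdE)
    have c: "[:a:] ^ p - [:a:] = of_nat p * [:k:]"
      using k by (simp add: poly_const_pow of_nat_poly)
    have "pcompose (pCons a f) (Polynomial.monom 1 p) = [:a:] + Polynomial.monom 1 p * pcompose f (Polynomial.monom 1 p)"
      by (simp add: pcompose_pCons)
    moreover have "(Polynomial.monom 1 1 * f) ^ p = Polynomial.monom 1 p * f ^ p"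
      by (simp add: power_mult_distrib monom_power)
    ultimately have "(pCons a f) ^ p - pcompose (pCons a f) (Polynomial.monom 1 p)
      = ((pCons a f) ^ p - ([:a:] ^ p + (Polynomial.monom 1 1 * f) ^ p)) + ([:a:] ^ p - [:a:])
        + Polynomial.monom 1 p * (f ^ p - pcompose f (Polynomial.monom 1 p))"
      by (simp add: algebra_simps)
    also have "\<dots> = of_nat p * (h + [:k:] + Polynomial.monom 1 p * g)"
      unfolding h c g by (simp add: algebra_simps)
    finally show ?case by blast
  qed
  then obtain g where g: "f ^ p - pcompose f (Polynomial.monom 1 p) = of_nat p * g" by blast
  have "poly (of_int_poly (f ^ p - pcompose f (Polynomial.monom 1 p))) z = poly (of_int_poly (of_nat p * g)) z"
    using g by simp
  then have "poly (of_int_poly f) z ^ p - poly (of_int_poly f) (z ^ p) = of_nat p * poly (of_int_poly g) z"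
    by (simp add: of_int_poly_hom.hom_minus of_int_poly_hom.hom_power of_int_poly_hom.hom_mult
        of_int_hom.map_poly_pcompose poly_pcompose map_poly_monom poly_monom of_nat_poly
        of_int_hom.map_poly_hom_smult)
  then show ?thesis by blast
qed

text \<open>This replaces the irreducibility of the cyclotomic polynomial. If h vanishes at z^k, the
  Frobenius congruence makes h(z^(k*p)) divisible by p in Z[z]; a nonzero value admits this only for
  finitely many p. Changing c modulo w avoids those primes.\<close>

lemma int_poly_root_of_unity_power:
  fixes h :: "int poly" and z :: complex
  assumes z: "z ^ w = 1" "w > 0" and root: "poly (of_int_poly h) z = 0" and c: "coprime c w"
  shows "poly (of_int_poly h) (z ^ c) = 0"
proof -
  define val where "val k = poly (of_int_poly h) (z ^ k)" for k
  have val_mod: "val (k mod w) = val k" for k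
    unfolding val_def
    by (metis z(1) div_mult_mod_eq lambda_one mult.commute power_add power_mult power_one)
  have val_in: "val k \<in> int_adjoin z" for k
    unfolding val_def by (rule int_adjoin_subset[of "z ^ k"]) auto
  have "\<exists>n y. n \<noteq> 0 \<and> y \<in> int_adjoin z \<and> of_int n = val k * y" if "val k \<noteq> 0" for k
    using int_adjoin_nonzero_dvd_int[OF z val_in that] by metis
  then obtain n y where ny: "\<And>k. val k \<noteq> 0 \<Longrightarrow> n k \<noteq> 0 \<and> y k \<in> int_adjoin z \<and> of_int (n k) = val k * y k"
    by metis
  \<comment> \<open>Every nonzero value h(z^k) divides the integer \<open>n k\<close>, hence
    \<open>N\<close>. A prime that divides such a value in Z[z] must therefore divide
    \<open>N\<close>.\<close>
  define N where "N = nat \<bar>\<Prod>k\<in>{k. k < w \<and> val k \<noteq> 0}. n k\<bar>"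
  have N0: "N \<noteq> 0" unfolding N_def using ny by auto
  have prime_step: "val (k * p) = 0" if p: "Factorial_Ring.prime p" "\<not> p dvd N" and k: "val k = 0" for p k
  proof (rule ccontr)
    assume "val (k * p) \<noteq> 0"
    then have nz: "val (k * p mod w) \<noteq> 0" by (simp add: val_mod)
    have "\<exists>y\<in>int_adjoin (z ^ k). val k ^ p - val (k * p) = of_nat p * y"
      using int_poly_frobenius[OF p(1), where f = h and z = "z ^ k"] unfolding val_def power_mult .
    then obtain u where u: "u \<in> int_adjoin (z ^ k)" "val k ^ p - val (k * p) = of_nat p * u" by blast
    have "u \<in> int_adjoin z" by (rule int_adjoin_subset[of "z ^ k"]) (use u in auto)
    moreover have "val (k * p) = - (of_nat p * u)"
      using u(2) k prime_gt_0_nat[OF p(1)] by (simp add: power_0_left minus_equation_iff[of "val (k * p)"])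
    ultimately have "- (u * y (k * p mod w)) \<in> int_adjoin z"
      and "of_int (n (k * p mod w)) = of_int (int p) * (- (u * y (k * p mod w)))"
      using ny[OF nz] by (simp_all add: val_mod int_adjoin_mult int_adjoin_uminus)
    then have "int p dvd n (k * p mod w)" using int_adjoin_dvd_imp_dvd[OF z] by blast
    moreover have "n (k * p mod w) dvd (\<Prod>k\<in>{k. k < w \<and> val k \<noteq> 0}. n k)"
      using nz z(2) by (intro dvd_prodI) auto
    ultimately have "int p dvd (\<Prod>k\<in>{k. k < w \<and> val k \<noteq> 0}. n k)" by (rule dvd_trans)
    then have "int p dvd int N" unfolding N_def by simp
    then show False using p(2) by (simp only: int_dvd_int_iff)
  qed
  have mult: "d > 0 \<longrightarrow> coprime d N \<longrightarrow> (\<forall>k. val k = 0 \<longrightarrow> val (k * d) = 0)" for d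
  proof (induction d rule: prime_divisors_induct)
    case (factor p d)
    show ?case
    proof (intro impI allI)
      fix k assume *: "p * d > 0" "coprime (p * d) N" "val k = 0"
      then have "\<not> p dvd N"
        using factor(1) by (metis coprime_mult_left_iff coprime_absorb_left not_prime_unit)
      with * factor have "val (k * p * d) = 0" using prime_step by simp
      then show "val (k * (p * d)) = 0" by (simp add: mult.assoc)
    qed
  qed auto
  \<comment> \<open>With this choice each prime factor of \<open>N\<close> divides exactly one of
    \<open>c\<close> and \<open>w * M\<close>, because \<open>c\<close> is coprime to
    \<open>w\<close>. So \<open>c + w * M\<close> is coprime to \<open>N\<close>, without
    Dirichlet's theorem on primes in progressions.\<close>
  define M where "M = \<Prod>{p\<in>prime_factors N. \<not> p dvd c}"
  have M0: "M > 0" unfolding M_def by (auto intro!: prod_pos prime_gt_0_nat)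
  have "coprime (c + w * M) N"
  proof (rule ccontr)
    assume "\<not> coprime (c + w * M) N"
    then obtain p where p: "Factorial_Ring.prime p" "p dvd c + w * M" "p dvd N"
      using N0 by (metis coprime_iff_gcd_eq_1 gcd_nat.bounded_iff prime_factor_nat)
    show False
    proof (cases "p dvd c")
      case True
      then have "p dvd w * M" using p(2) dvd_add_right_iff by blast
      moreover have "\<not> p dvd w" using c True p(1) by (metis coprime_common_divisor not_prime_unit)
      ultimately have "p dvd M" using p(1) prime_dvd_mult_iff by blast
      then obtain r where "r \<in> {p\<in>prime_factors N. \<not> p dvd c}" "p dvd r"
        unfolding M_def using p(1) by (auto simp: prime_dvd_prod_iff)
      with True p(1) show False by (auto dest: primes_dvd_imp_eq)
    next
      case False
      then have "p dvd M" unfolding M_def using p N0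
        by (intro dvd_prod_eqI[of _ p]) (auto simp: prime_factors_dvd)
      then show False using False p(2) by (metis dvd_add_left_iff dvd_mult)
    qed
  qed
  moreover have "c + w * M > 0" using M0 z by simp
  moreover have "val 1 = 0" using root by (simp add: val_def)
  ultimately have "val (1 * (c + w * M)) = 0"
    using mult[rule_format, of "c + w * M" 1] by fast
  moreover have "val (c + w * M) = val c"
    using val_mod[of c] val_mod[of "c + w * M"] by (simp only: mod_mult_self2)
  ultimately show ?thesis by (simp add: val_def)
qed

section \<open>Self-conjugate primes\<close>

text \<open>Congruence modulo the principal ideal of \<pi> in Z[z]. The modulus will be p if p does
  not divide w, and 1 - z^u if w = p * u.\<close>

definition adjoin_cong :: "complex \<Rightarrow> complex \<Rightarrow> complex \<Rightarrow> complex \<Rightarrow> bool" where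
  "adjoin_cong z \<pi> x y \<longleftrightarrow> (\<exists>d\<in>int_adjoin z. x - y = \<pi> * d)"

lemma adjoin_cong_refl [simp, intro]: "adjoin_cong z \<pi> x x"
  unfolding adjoin_cong_def by (rule bexI[of _ 0]) auto

lemma adjoin_cong_sym: "adjoin_cong z \<pi> x y \<Longrightarrow> adjoin_cong z \<pi> y x"
  unfolding adjoin_cong_def by (metis int_adjoin_uminus minus_diff_eq mult_minus_right)

lemma adjoin_cong_trans [trans]:
  assumes "adjoin_cong z \<pi> x y" "adjoin_cong z \<pi> y t"
  shows "adjoin_cong z \<pi> x t"
proof -
  from assms obtain d e where "d \<in> int_adjoin z" "e \<in> int_adjoin z" "x - y = \<pi> * d" "y - t = \<pi> * e"
    by (auto simp: adjoin_cong_def)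
  then have "d + e \<in> int_adjoin z" "x - t = \<pi> * (d + e)" by (auto simp: algebra_simps)
  then show ?thesis unfolding adjoin_cong_def by blast
qed

lemma adjoin_cong_mult:
  assumes "adjoin_cong z \<pi> x y" "adjoin_cong z \<pi> x' y'" "x \<in> int_adjoin z" "y' \<in> int_adjoin z"
  shows "adjoin_cong z \<pi> (x * x') (y * y')"
proof -
  from assms obtain d e where *: "d \<in> int_adjoin z" "e \<in> int_adjoin z" "x - y = \<pi> * d" "x' - y' = \<pi> * e"
    by (auto simp: adjoin_cong_def)
  have "x * x' - y * y' = x * (x' - y') + (x - y) * y'" by (simp add: algebra_simps)
  also have "\<dots> = \<pi> * (x * e + d * y')" unfolding * by (simp add: algebra_simps)
  finally show ?thesis unfolding adjoin_cong_def using * assms(3,4) by blast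
qed

lemma adjoin_cong_add:
  assumes "adjoin_cong z \<pi> x y" "adjoin_cong z \<pi> x' y'"
  shows "adjoin_cong z \<pi> (x + x') (y + y')"
proof -
  from assms obtain d e where *: "d \<in> int_adjoin z" "e \<in> int_adjoin z" "x - y = \<pi> * d" "x' - y' = \<pi> * e"
    by (auto simp: adjoin_cong_def)
  have "(x + x') - (y + y') = (x - y) + (x' - y')" by (simp add: algebra_simps)
  also have "\<dots> = \<pi> * (d + e)" unfolding * by (simp add: algebra_simps)
  finally show ?thesis unfolding adjoin_cong_def using * by blast
qed

lemma adjoin_cong_power:
  assumes "adjoin_cong z \<pi> x y" "x \<in> int_adjoin z" "y \<in> int_adjoin z"
  shows "adjoin_cong z \<pi> (x ^ n) (y ^ n)"
  by (induction n) (use assms in \<open>auto intro!: adjoin_cong_mult\<close>)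

lemma adjoin_cong_poly:
  assumes "adjoin_cong z \<pi> x y" "x \<in> int_adjoin z" "y \<in> int_adjoin z"
  shows "adjoin_cong z \<pi> (poly (of_int_poly f) x) (poly (of_int_poly f) y)"
proof (induction f)
  case (pCons a f)
  have "poly (of_int_poly f) y \<in> int_adjoin z"
    using assms int_adjoin_poly int_adjoin_subset by blast
  with pCons assms show ?case
    by (simp add: of_int_hom.map_poly_pCons_hom) (intro adjoin_cong_add adjoin_cong_mult; simp)
qed simp

lemma adjoin_cong_exponent:
  assumes "adjoin_cong z \<pi> (z ^ u) 1" "[i = j] (mod u)"
  shows "adjoin_cong z \<pi> (z ^ i) (z ^ j)"
proof -
  have *: "adjoin_cong z \<pi> (z ^ (i + u * k)) (z ^ i)" for i k
  proof -
    have "adjoin_cong z \<pi> ((z ^ u) ^ k) (1 ^ k)"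
      by (rule adjoin_cong_power) (use assms in auto)
    then have "adjoin_cong z \<pi> (z ^ i * (z ^ u) ^ k) (z ^ i * 1)"
      by (intro adjoin_cong_mult) auto
    then show ?thesis by (simp add: power_add power_mult)
  qed
  show ?thesis
  proof (cases "i \<le> j")
    case True
    then obtain k where "j = i + u * k" using assms(2)
      by (metis cong_def dvdE le_add_diff_inverse mod_eq_dvd_iff_nat)
    then show ?thesis using * adjoin_cong_sym by blast
  next
    case False
    then obtain k where "i = j + u * k" using assms(2)
      by (metis cong_def dvdE le_add_diff_inverse mod_eq_dvd_iff_nat nat_le_linear)
    then show ?thesis using * by blast
  qed
qed

lemma adjoin_cong_frobenius_iterate:
  assumes p: "Factorial_Ring.prime p" and \<pi>: "of_nat p = \<pi> * a" "a \<in> int_adjoin z"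
  shows "adjoin_cong z \<pi> (poly (of_int_poly f) z ^ (p ^ r)) (poly (of_int_poly f) (z ^ (p ^ r)))"
proof (induction r)
  case (Suc r)
  let ?x = "z ^ (p ^ r)"
  have in_adj: "poly (of_int_poly f) ?x \<in> int_adjoin z"
    using int_adjoin_poly int_adjoin_subset int_adjoin_power int_adjoin_self by blast
  have "adjoin_cong z \<pi> ((poly (of_int_poly f) z ^ (p ^ r)) ^ p) (poly (of_int_poly f) ?x ^ p)"
    by (rule adjoin_cong_power) (use Suc in_adj in auto)
  also have "adjoin_cong z \<pi> (poly (of_int_poly f) ?x ^ p) (poly (of_int_poly f) (?x ^ p))"
  proof -
    obtain y where y: "y \<in> int_adjoin ?x"
      "poly (of_int_poly f) ?x ^ p - poly (of_int_poly f) (?x ^ p) = of_nat p * y"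
      using int_poly_frobenius[OF p] by blast
    have "y \<in> int_adjoin z" using y(1) int_adjoin_subset int_adjoin_power int_adjoin_self by blast
    then have "a * y \<in> int_adjoin z" "of_nat p * y = \<pi> * (a * y)" using \<pi> by auto
    then show ?thesis using y(2) unfolding adjoin_cong_def by metis
  qed
  finally show ?case by (simp add: mult.commute flip: power_mult)
qed simp

lemma cnj_root_of_unity:
  assumes "z ^ w = 1" "w > 0"
  shows "cnj z = z ^ (w - 1)" "cnj z * z = 1"
proof -
  have "norm z = 1" using assms power_eq_1_iff by blast
  then show 1: "cnj z * z = 1"
    by (metis complex_norm_square mult.commute of_real_1 one_power2)
  have "z * z ^ (w - 1) = 1" using assms by (metis power_eq_if not_less_zero)
  then show "cnj z = z ^ (w - 1)" using 1 by (metis mult.assoc mult.left_neutral mult.right_neutral)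
qed

lemma cnj_int_poly: "cnj (poly (of_int_poly f) z) = poly (of_int_poly f) (cnj z)"
  by (induction f) (auto simp: of_int_hom.map_poly_pCons_hom)

lemma int_adjoin_cnj:
  assumes "z ^ w = 1" "w > 0" "x \<in> int_adjoin z"
  shows "cnj x \<in> int_adjoin z"
proof -
  obtain f where "x = poly (of_int_poly f) z" using assms(3) by (rule int_adjoinE)
  then have "cnj x = poly (of_int_poly f) (z ^ (w - 1))"
    using cnj_root_of_unity(1)[OF assms(1,2)] by (simp add: cnj_int_poly)
  then show ?thesis using int_adjoin_subset[of "z ^ (w - 1)"] by auto
qed

text \<open>Modulo \<open>\<pi>\<close>, raising to the power \<open>p ^ r\<close> is complex conjugation and raising to the power
  \<open>p ^ (2 * r)\<close> is the identity.\<close>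
lemma self_conjugate_dvd:
  assumes z: "z ^ w = 1" "w > 0" and p: "Factorial_Ring.prime p"
    and \<pi>: "of_nat p = \<pi> * a" "a \<in> int_adjoin z"
    and u: "u dvd w" "coprime u p" "adjoin_cong z \<pi> (z ^ u) 1" and r: "[int p ^ r = - 1] (mod int u)"
    and x: "x \<in> int_adjoin z" and dvd: "y \<in> int_adjoin z" "x * cnj x = \<pi> * y"
  shows "\<exists>y\<in>int_adjoin z. x = \<pi> * y"
proof -
  \<comment> \<open>The exponent 0 can occur only if u divides 2, and then exponent 1 serves as
    well. A positive r ensures p^r + 1 \<le> p^(2*r) below.\<close>
  obtain r where r0: "r > 0" and r: "[int p ^ r = - 1] (mod int u)"
  proof (cases "r = 0")
    case True
    then have "int u dvd 2" using r by (simp add: cong_iff_dvd_diff)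
    then have "u dvd 2" by presburger
    then have "u = 1 \<or> u = 2" using dvd_imp_le[of u 2] by (cases "u = 0") auto
    then have "[int p ^ 1 = - 1] (mod int u)"
    proof
      assume "u = 2"
      then have "odd p" using u(2) by auto
      then show ?thesis using \<open>u = 2\<close> by (simp add: cong_iff_dvd_diff)
    qed auto
    then show ?thesis by (rule that[rotated]) simp
  qed (use r that in auto)
  obtain f where f: "x = poly (of_int_poly f) z" using x by (rule int_adjoinE)
  have frob: "adjoin_cong z \<pi> (x ^ (p ^ s)) (poly (of_int_poly f) (z ^ j))" if "[p ^ s = j] (mod u)" for s j
  proof -
    have "adjoin_cong z \<pi> (x ^ (p ^ s)) (poly (of_int_poly f) (z ^ (p ^ s)))"
      unfolding f by (rule adjoin_cong_frobenius_iterate[OF p \<pi>])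
    also have "adjoin_cong z \<pi> \<dots> (poly (of_int_poly f) (z ^ j))"
      by (intro adjoin_cong_poly adjoin_cong_exponent[OF u(3) that]) auto
    finally show ?thesis .
  qed
  have "[p ^ r = w - 1] (mod u)"
  proof -
    have "[int w - 1 = - 1] (mod int u)" using u(1) by (simp add: cong_iff_dvd_diff)
    then have "[int p ^ r = int w - 1] (mod int u)" using r by (metis cong_sym cong_trans)
    then have "[int (p ^ r) = int (w - 1)] (mod int u)" using z(2) by (simp add: of_nat_diff)
    then show ?thesis by (simp only: cong_int_iff)
  qed
  from frob[OF this] have conj: "adjoin_cong z \<pi> (x ^ (p ^ r)) (cnj x)"
    by (simp add: f cnj_int_poly cnj_root_of_unity(1)[OF z])
  have "[p ^ (2 * r) = 1] (mod u)"
  proof -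
    have "[(int p ^ r) ^ 2 = (- 1) ^ 2] (mod int u)" using r by (rule cong_pow)
    then have "[int (p ^ (2 * r)) = int 1] (mod int u)" by (simp add: mult.commute flip: power_mult)
    then show ?thesis by (simp only: cong_int_iff)
  qed
  from frob[OF this] have "adjoin_cong z \<pi> x (x ^ (p ^ (2 * r)))" by (simp add: f adjoin_cong_sym)
  moreover have "adjoin_cong z \<pi> (x ^ (p ^ (2 * r))) 0"
  proof -
    \<comment> \<open>The power x^(p^(2*r)) thus contains the factor x * x^(p^r), which is congruent
      to x * cnj x and so to 0.\<close>
    have "p ^ r + 1 \<le> p ^ (2 * r)"
      using r0 prime_gt_1_nat[OF p] by (simp add: Suc_le_eq power_strict_increasing)
    then have "x ^ (p ^ (2 * r)) = x * x ^ (p ^ r) * x ^ (p ^ (2 * r) - (p ^ r + 1))"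
      by (metis add.commute le_add_diff_inverse power_Suc power_add plus_1_eq_Suc)
    moreover have "adjoin_cong z \<pi> (x * cnj x) 0" using dvd by (auto simp: adjoin_cong_def)
    moreover have "adjoin_cong z \<pi> (x * x ^ (p ^ r)) (x * cnj x)"
      using conj x by (intro adjoin_cong_mult) (auto intro: int_adjoin_cnj[OF z])
    then have "adjoin_cong z \<pi> (x * x ^ (p ^ r)) 0" by (rule adjoin_cong_trans) fact
    then have "adjoin_cong z \<pi> (x * x ^ (p ^ r) * x ^ (p ^ (2 * r) - (p ^ r + 1)))
        (0 * x ^ (p ^ (2 * r) - (p ^ r + 1)))"
      by (rule adjoin_cong_mult) (use x in auto)
    ultimately show ?thesis by simp
  qed
  ultimately have "adjoin_cong z \<pi> x 0" by (rule adjoin_cong_trans)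
  then show ?thesis by (simp add: adjoin_cong_def)
qed

text \<open>Descent: writing x = \<pi> * x' removes \<pi> * cnj \<pi> from the norm. As \<pi> is a
  multiple of its conjugate, this counts as removing \<pi>^2, at the price of the factor c.\<close>

lemma self_conjugate_power_dvd:
  assumes z: "z ^ w = 1" "w > 0" and p: "Factorial_Ring.prime p"
    and \<pi>: "of_nat p = \<pi> * a" "a \<in> int_adjoin z" "\<pi> \<in> int_adjoin z"
    and c: "\<pi> = cnj \<pi> * c" "c \<in> int_adjoin z"
    and u: "u dvd w" "coprime u p" "adjoin_cong z \<pi> (z ^ u) 1" and r: "[int p ^ r = - 1] (mod int u)"
    and x: "x \<in> int_adjoin z" and dvd: "y \<in> int_adjoin z" "x * cnj x = \<pi> ^ (2 * k) * y"
  shows "\<exists>y\<in>int_adjoin z. x = \<pi> ^ k * y"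
  using x dvd
proof (induction k arbitrary: x y)
  case (Suc k)
  have \<pi>0: "\<pi> \<noteq> 0" using \<pi> p by auto
  have "x * cnj x = \<pi> * (\<pi> ^ (2 * k + 1) * y)" using Suc.prems(3) by simp
  moreover have "\<pi> ^ (2 * k + 1) * y \<in> int_adjoin z" using Suc.prems(2) \<pi>(3) by blast
  ultimately obtain x' where x': "x' \<in> int_adjoin z" "x = \<pi> * x'"
    using self_conjugate_dvd[OF z p \<pi>(1,2) u r Suc.prems(1)] by metis
  have "\<pi> ^ 2 * (x' * cnj x') = (\<pi> * x') * (cnj \<pi> * cnj x') * c"
    using c(1) by (metis (no_types, lifting) mult.assoc mult.commute power2_eq_square)
  also have "\<dots> = \<pi> ^ (2 * Suc k) * y * c" using Suc.prems(3) x'(2) by simp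
  also have "\<dots> = \<pi> ^ 2 * (\<pi> ^ (2 * k) * (y * c))" by (simp add: power2_eq_square)
  finally have "x' * cnj x' = \<pi> ^ (2 * k) * (y * c)" using \<pi>0 by simp
  then have "\<exists>t\<in>int_adjoin z. x' = \<pi> ^ k * t"
    using Suc.IH[OF x'(1), of "y * c"] Suc.prems c by blast
  then show ?case using x'(2) by auto
qed auto

section \<open>Norms that are powers of p: the unramified and the ramified case\<close>

lemma prod_one_minus_root_of_unity_powers:
  fixes \<eta> :: complex
  assumes \<eta>: "\<eta> ^ p = 1" "p > 0" "inj_on (\<lambda>k. \<eta> ^ k) {..<p}"
  shows "(\<Prod>k\<in>{1..<p}. 1 - \<eta> ^ k) = of_nat p"
proof -
  \<comment> \<open>Both \<open>P\<close> and \<open>Q\<close> are the polynomial (X^p - 1) / (X -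
    1), once factored and once expanded; the claim compares their values at 1.\<close>
  define P where "P = (\<Prod>k\<in>{1..<p}. [:- (\<eta> ^ k), 1:])"
  define Q where "Q = (\<Sum>k<p. Polynomial.monom (1 :: complex) k)"
  have "P = Q"
  proof (rule poly_eqI_degree_lead_coeff[where n = "p - 1" and A = "(\<lambda>k. \<eta> ^ k) ` {1..<p}"])
    have degP: "degree P = p - 1"
      unfolding P_def by (subst degree_prod_eq_sum_degree) auto
    then show "degree P \<le> p - 1" by simp
    show "degree Q \<le> p - 1"
      unfolding Q_def by (intro degree_sum_le) (auto intro: degree_monom_le order_trans)
    have "lead_coeff P = 1" unfolding P_def by (subst lead_coeff_prod) simp
    moreover have "Polynomial.coeff Q (p - 1) = 1"
      unfolding Q_def using \<eta>(2) by (simp add: coeff_sum if_distrib cong: if_cong)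
    ultimately show "Polynomial.coeff P (p - 1) = Polynomial.coeff Q (p - 1)"
      using degP by simp
    have "inj_on (\<lambda>k. \<eta> ^ k) {1..<p}" by (rule inj_on_subset[OF \<eta>(3)]) auto
    then show "p - 1 \<le> card ((\<lambda>k. \<eta> ^ k) ` {1..<p})" by (simp add: card_image)
    fix x assume "x \<in> (\<lambda>k. \<eta> ^ k) ` {1..<p}"
    then obtain k where k: "k \<in> {1..<p}" "x = \<eta> ^ k" by auto
    have "x \<noteq> 1" using inj_onD[OF \<eta>(3), of k 0] k \<eta>(2) by auto
    have "x ^ p = 1" unfolding k(2) by (metis \<eta>(1) mult.commute power_mult power_one)
    have "poly P x = 0" unfolding P_def poly_prod using k by (intro prod_zero) auto
    moreover have "poly Q x = (\<Sum>k<p. x ^ k)" by (simp add: Q_def poly_sum poly_monom)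
    then have "(1 - x) * poly Q x = 0" using \<open>x ^ p = 1\<close> by (simp flip: one_diff_power_eq)
    with \<open>x \<noteq> 1\<close> have "poly Q x = 0" by simp
    ultimately show "poly P x = poly Q x" by simp
  qed
  then have "poly P 1 = poly Q 1" by simp
  then show ?thesis by (simp add: P_def Q_def poly_prod poly_sum poly_monom)
qed

text \<open>Here \<pi> = p. For odd n, the division leaves y with y * cnj y = p; then p divides y
  once more, so p^2 divides p in Z[z], which integrality forbids.\<close>

lemma self_conjugate_norm_power_unramified:
  assumes z: "z ^ w = 1" "w > 0" and p: "Factorial_Ring.prime p" "coprime w p"
    and r: "[int p ^ r = - 1] (mod int w)"
    and x: "x \<in> int_adjoin z" "x * cnj x = of_nat p ^ n"
  shows "even n" "\<exists>y\<in>int_adjoin z. x = of_nat p ^ (n div 2) * y"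
proof -
  let ?p = "of_nat p :: complex"
  have p0: "?p \<noteq> 0" using p by auto
  have \<pi>: "?p = ?p * 1" "1 \<in> int_adjoin z" "?p \<in> int_adjoin z" by auto
  have c: "?p = cnj ?p * 1" by simp
  have u: "w dvd w" "coprime w p" "adjoin_cong z ?p (z ^ w) 1" using p z by auto
  have eq: "x * cnj x = ?p ^ (2 * (n div 2)) * ?p ^ (n mod 2)"
    unfolding x(2) power_add[symmetric] by simp
  show ex: "\<exists>y\<in>int_adjoin z. x = ?p ^ (n div 2) * y"
    by (rule self_conjugate_power_dvd[OF z p(1) \<pi> c \<pi>(2) u r x(1) _ eq]) auto
  then obtain y where y: "y \<in> int_adjoin z" "x = ?p ^ (n div 2) * y" by blast
  show "even n"
  proof (rule ccontr)
    assume "odd n"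
    then have "n mod 2 = 1" by presburger
    then have "?p ^ (2 * (n div 2)) * (y * cnj y) = ?p ^ (2 * (n div 2)) * ?p"
      using eq y(2) by (simp add: mult_2 power_add)
    then have y_cnj: "y * cnj y = ?p * 1" using p0 by simp
    obtain t where t: "t \<in> int_adjoin z" "y = ?p * t"
      using self_conjugate_dvd[OF z p(1) \<pi>(1,2) u r y(1) _ y_cnj] by auto
    have "?p * (?p * (t * cnj t)) = y * cnj y" unfolding t(2) by (simp add: mult_ac)
    then have "?p * (?p * (t * cnj t)) = ?p * 1" using y_cnj by simp
    then have "?p * (t * cnj t) = 1" using p0 by (simp only: mult_left_cancel not_False_eq_True)
    then have "of_int 1 = of_int (int p) * (t * cnj t)" by simp
    moreover have "t * cnj t \<in> int_adjoin z" using t(1) int_adjoin_cnj[OF z] by blast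
    ultimately have "int p dvd 1" using int_adjoin_dvd_imp_dvd[OF z] by blast
    then show False using p(1) by auto
  qed
qed

text \<open>Here \<pi> = 1 - \<eta> with \<eta> = z^u of order p, so z^u is 1 modulo \<pi> and
  exponents matter only modulo u. Parity of n cannot be expected: quadratic Gauss sums have norm
  p.\<close>

lemma self_conjugate_norm_power_ramified:
  assumes z: "z ^ (p * u) = 1" "u > 0" "inj_on (\<lambda>k. z ^ k) {..<p * u}"
    and p: "Factorial_Ring.prime p" "coprime u p"
    and r: "[int p ^ r = - 1] (mod int u)"
    and x: "x \<in> int_adjoin z" "x * cnj x = of_nat p ^ n"
  shows "\<exists>y\<in>int_adjoin z. x = of_nat p ^ (n div 2) * y"
proof -
  let ?p = "of_nat p :: complex"
  define \<eta> where "\<eta> = z ^ u"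
  define \<pi> where "\<pi> = 1 - \<eta>"
  have p0: "p > 0" and p2: "p \<ge> 2" using p(1) prime_gt_0_nat prime_ge_2_nat by auto
  have z': "z ^ (p * u) = 1" "p * u > 0" using z p0 by auto
  have \<eta>_in: "\<eta> \<in> int_adjoin z" unfolding \<eta>_def by auto
  then have \<pi>_in: "\<pi> \<in> int_adjoin z" unfolding \<pi>_def by auto
  have \<eta>p: "\<eta> ^ p = 1" unfolding \<eta>_def using z by (simp add: mult.commute flip: power_mult)
  have \<eta>_inj: "inj_on (\<lambda>k. \<eta> ^ k) {..<p}"
  proof (rule inj_onI)
    fix i j assume ij: "i \<in> {..<p}" "j \<in> {..<p}" "\<eta> ^ i = \<eta> ^ j"
    then have "z ^ (u * i) = z ^ (u * j)" by (simp add: \<eta>_def power_mult)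
    moreover have "u * i < p * u" "u * j < p * u" using ij z(2) by (simp_all add: mult.commute)
    ultimately have "u * i = u * j" using inj_onD[OF z(3)] unfolding lessThan_iff by metis
    then show "i = j" using z(2) by simp
  qed
  define g where "g k = (\<Sum>i<k. \<eta> ^ i)" for k
  have g: "1 - \<eta> ^ k = \<pi> * g k" "g k \<in> int_adjoin z" for k
    unfolding g_def \<pi>_def using \<eta>_in by (auto simp: one_diff_power_eq)
  \<comment> \<open>As k is invertible modulo p, \<eta> is a power of \<eta>^k, so the divisibility
    in \<open>g\<close> also holds in reverse. Hence the product of all 1 - \<eta>^k, which is p,
    and \<pi>^(p-1) divide each other.\<close>
  have "\<exists>h\<in>int_adjoin z. \<pi> = (1 - \<eta> ^ k) * h" if "k \<in> {1..<p}" for k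
  proof -
    have "coprime k p" using that p(1)
      by (metis atLeastLessThan_iff coprime_commute less_le_not_le nat_dvd_not_less not_one_le_zero
          prime_imp_coprime less_eq_Suc_le One_nat_def)
    then obtain l where l: "[k * l = 1] (mod p)" using cong_solve_coprime_nat by auto
    have "\<eta> ^ (k * l) = \<eta> ^ 1"
    proof -
      have "\<eta> ^ (i mod p) = \<eta> ^ i" for i
        by (metis \<eta>p div_mult_mod_eq lambda_one mult.commute power_add power_mult power_one)
      then show ?thesis using l unfolding cong_def by metis
    qed
    then have "\<pi> = (1 - \<eta> ^ k) * (\<Sum>i<l. (\<eta> ^ k) ^ i)"
      unfolding \<pi>_def by (subst one_diff_power_eq[symmetric]) (simp add: power_mult)
    moreover have "(\<Sum>i<l. (\<eta> ^ k) ^ i) \<in> int_adjoin z" using \<eta>_in by auto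
    ultimately show ?thesis by blast
  qed
  then obtain h where h: "\<And>k. k \<in> {1..<p} \<Longrightarrow> h k \<in> int_adjoin z \<and> \<pi> = (1 - \<eta> ^ k) * h k"
    by metis
  define A where "A = (\<Prod>k\<in>{1..<p}. g k)"
  define B where "B = (\<Prod>k\<in>{1..<p}. h k)"
  have AB_in: "A \<in> int_adjoin z" "B \<in> int_adjoin z" unfolding A_def B_def using g h by auto
  have pA: "?p = \<pi> ^ (p - 1) * A"
    using prod_one_minus_root_of_unity_powers[OF \<eta>p p0 \<eta>_inj] by (simp add: g(1) A_def prod.distrib)
  have pB: "\<pi> ^ (p - 1) = ?p * B"
  proof -
    have "\<pi> ^ (p - 1) = (\<Prod>k\<in>{1..<p}. \<pi>)" by simp
    also have "\<dots> = (\<Prod>k\<in>{1..<p}. (1 - \<eta> ^ k) * h k)" by (rule prod.cong) (use h in auto)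
    also have "\<dots> = ?p * B"
      using prod_one_minus_root_of_unity_powers[OF \<eta>p p0 \<eta>_inj] by (simp add: B_def prod.distrib)
    finally show ?thesis .
  qed
  have "p - 1 = Suc (p - 2)" using p2 by simp
  then have pa: "?p = \<pi> * (\<pi> ^ (p - 2) * A)" using pA by simp
  have pa_in: "\<pi> ^ (p - 2) * A \<in> int_adjoin z" using AB_in \<pi>_in by auto
  have "cnj \<eta> * \<eta> = 1" using cnj_root_of_unity(2)[OF \<eta>p p0] .
  then have c: "\<pi> = cnj \<pi> * (- \<eta>)" unfolding \<pi>_def by (simp add: algebra_simps)
  have c_in: "- \<eta> \<in> int_adjoin z" using \<eta>_in by auto
  have "z ^ u - 1 = \<pi> * (- 1)" by (simp add: \<pi>_def \<eta>_def)
  then have cong: "adjoin_cong z \<pi> (z ^ u) 1" unfolding adjoin_cong_def by blast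
  \<comment> \<open>Since p^n is a multiple of \<pi>^((p-1)*n), the descent may take out
    \<pi>^((p-1)*(n div 2)), which is exactly p^(n div 2) up to the factor from
    \<open>B\<close>.\<close>
  have le: "2 * ((p - 1) * (n div 2)) \<le> (p - 1) * n" by (simp add: mult.left_commute)
  have "x * cnj x = (\<pi> ^ (p - 1) * A) ^ n" using x(2) pA by simp
  also have "\<dots> = \<pi> ^ ((p - 1) * n) * A ^ n" by (simp add: power_mult_distrib power_mult)
  also have "\<dots> = \<pi> ^ (2 * ((p - 1) * (n div 2))) * (\<pi> ^ ((p - 1) * n - 2 * ((p - 1) * (n div 2))) * A ^ n)"
    unfolding mult.assoc[symmetric] power_add[symmetric] using le by simp
  finally have eq: "x * cnj x = \<dots>" .
  have "\<pi> ^ ((p - 1) * n - 2 * ((p - 1) * (n div 2))) * A ^ n \<in> int_adjoin z" using \<pi>_in AB_in by auto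
  then obtain y where y: "y \<in> int_adjoin z" "x = \<pi> ^ ((p - 1) * (n div 2)) * y"
    using self_conjugate_power_dvd[OF z' p(1) pa pa_in \<pi>_in c c_in _ p(2) cong r x(1) _ eq] by auto
  have "x = (?p * B) ^ (n div 2) * y" using y(2) unfolding power_mult pB .
  then have "x = ?p ^ (n div 2) * (B ^ (n div 2) * y)" by (simp add: power_mult_distrib)
  then show ?thesis using y(1) AB_in by blast
qed

lemma self_conjugate_norm_power:
  assumes z: "z ^ w = 1" "w > 0" "inj_on (\<lambda>k. z ^ k) {..<w}"
    and p: "Factorial_Ring.prime p" "self_conjugate_modulo p w" "\<not> p ^ 2 dvd w"
    and x: "x \<in> int_adjoin z" "x * cnj x = of_nat p ^ n"
  shows "\<exists>y\<in>int_adjoin z. x = of_nat p ^ (n div 2) * y" "\<not> p dvd w \<Longrightarrow> even n"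
proof -
  obtain s u r where w: "w = p ^ s * u" "coprime u p" and r: "[int p ^ r = - 1] (mod int u)"
    using p(2) by (auto simp: self_conjugate_modulo_def)
  have "s < 2"
  proof (rule ccontr)
    assume "\<not> s < 2"
    then have "p ^ 2 dvd w" unfolding w(1) by (simp add: le_imp_power_dvd dvd_mult2)
    then show False using p(3) by simp
  qed
  then consider "s = 0" | "s = 1" by linarith
  then show "\<exists>y\<in>int_adjoin z. x = of_nat p ^ (n div 2) * y"
  proof cases
    case 1
    then have "u = w" using w by simp
    with w r have "coprime w p" "[int p ^ r = - 1] (mod int w)" by simp_all
    then show ?thesis using self_conjugate_norm_power_unramified(2)[OF z(1,2) p(1) _ _ x] by blast
  next
    case 2
    then have "w = p * u" using w by simp
    then show ?thesis using self_conjugate_norm_power_ramified[OF _ _ _ p(1) w(2) r x] z by simp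
  qed
  show "even n" if "\<not> p dvd w"
  proof -
    have "s = 0" using that w by (cases s) auto
    then have "u = w" using w by simp
    with w r have "coprime w p" "[int p ^ r = - 1] (mod int w)" by simp_all
    then show ?thesis using self_conjugate_norm_power_unramified(1)[OF z(1,2) p(1) _ _ x] by blast
  qed
qed

section \<open>Homomorphisms onto cyclic groups\<close>

text \<open>A surjective q-th power map on a finite group is injective, but Sylow's theorem with
  exponent 1 supplies nontrivial elements of order q, which it sends to the identity.\<close>

lemma (in comm_group) power_image_proper:
  assumes fin: "finite (carrier G)" and q: "Factorial_Ring.prime q" "q dvd Coset.order G"
  shows "(\<lambda>x. x [^] q) ` carrier G \<noteq> carrier G"
proof
  assume surj: "(\<lambda>x. x [^] q) ` carrier G = carrier G"
  have inj: "inj_on (\<lambda>x. x [^] q) (carrier G)"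
    by (rule eq_card_imp_inj_on[OF fin]) (simp add: surj)
  obtain n where "Coset.order G = q ^ 1 * n" using q(2) by (auto elim: dvdE)
  then obtain H where H: "subgroup H G" "card H = q ^ 1"
    using sylow_thm[OF q(1) is_group _ fin] by blast
  have "\<not> H \<subseteq> {\<one>}"
  proof
    assume "H \<subseteq> {\<one>}"
    then have "card H \<le> card {\<one>}" by (intro card_mono) auto
    then show False using H(2) prime_gt_1_nat[OF q(1)] by simp
  qed
  then obtain x where x: "x \<in> H" "x \<noteq> \<one>" by blast
  have xG: "x \<in> carrier G" using x(1) H(1) subgroup.mem_carrier by metis
  have "x [^]\<^bsub>G\<lparr>carrier := H\<rparr>\<^esub> Coset.order (G\<lparr>carrier := H\<rparr>) = \<one>\<^bsub>G\<lparr>carrier := H\<rparr>\<^esub>"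
    by (rule group.pow_order_eq_1[OF subgroup.subgroup_is_group[OF H(1) is_group]]) (simp add: x)
  then have "x [^] q = \<one> [^] q"
    using H(2) by (simp add: Coset.order_def flip: nat_pow_consistent)
  then have "x = \<one>" using inj_onD[OF inj] xG by blast
  then show False using x(2) by simp
qed

text \<open>A homomorphism onto Z/w given by integer representatives, so that values for different
  moduli can be combined arithmetically. Reaching the generator 1 is enough for
  surjectivity.\<close>

definition surj_hom_mod :: "('a, 'b) monoid_scheme \<Rightarrow> int \<Rightarrow> ('a \<Rightarrow> int) \<Rightarrow> bool" where
  "surj_hom_mod G w f \<longleftrightarrow>
     (\<forall>x\<in>carrier G. \<forall>y\<in>carrier G. [f (x \<otimes>\<^bsub>G\<^esub> y) = f x + f y] (mod w)) \<and>
     (\<exists>x\<in>carrier G. [f x = 1] (mod w))"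

lemma (in comm_group) subgroup_adjoin_element:
  assumes H: "subgroup H G" and x: "x \<in> carrier G"
  shows "subgroup {x [^] (i :: int) \<otimes> h | i h. h \<in> H} G" (is "subgroup ?K G")
proof (rule subgroupI)
  note HG = subgroup.mem_carrier[OF H]
  show "?K \<subseteq> carrier G" using HG x by auto
  show "?K \<noteq> {}" using subgroup.one_closed[OF H] by auto
  fix a assume "a \<in> ?K"
  then obtain i :: int and h where a: "a = x [^] i \<otimes> h" "h \<in> H" by auto
  have "inv a = x [^] (- i) \<otimes> inv h" using a x HG by (simp add: inv_mult int_pow_neg)
  then show "inv a \<in> ?K" using subgroup.m_inv_closed[OF H] a(2) by auto
  fix b assume "b \<in> ?K"
  then obtain j :: int and k where b: "b = x [^] j \<otimes> k" "k \<in> H" by auto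
  have "a \<otimes> b = (x [^] i \<otimes> x [^] j) \<otimes> (h \<otimes> k)"
    using a b x HG by (simp add: m_ac)
  also have "\<dots> = x [^] (i + j) \<otimes> (h \<otimes> k)" using x by (simp add: int_pow_mult)
  finally show "a \<otimes> b \<in> ?K" using subgroup.m_closed[OF H a(2) b(2)] by blast
qed

text \<open>A subgroup that is maximal among the proper subgroups containing all \<open>q\<close>-th powers has
  index \<open>q\<close>; the homomorphism is the projection onto the quotient.\<close>
lemma (in comm_group) exists_surj_hom_mod_prime:
  assumes fin: "finite (carrier G)" and q: "Factorial_Ring.prime q" "q dvd Coset.order G"
  shows "\<exists>f. surj_hom_mod G (int q) f"
proof -
  define P where "P = (\<lambda>x. x [^] q) ` carrier G"
  have P: "subgroup P G"
  proof (rule subgroupI)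
    show "P \<subseteq> carrier G" "P \<noteq> {}" by (auto simp: P_def)
    fix a assume "a \<in> P"
    then obtain x where x: "x \<in> carrier G" "a = x [^] q" by (auto simp: P_def)
    then have "inv a = inv x [^] q" by (simp add: nat_pow_inv)
    then show "inv a \<in> P" using x by (auto simp: P_def)
    fix b assume "b \<in> P"
    then obtain y where y: "y \<in> carrier G" "b = y [^] q" by (auto simp: P_def)
    then have "a \<otimes> b = (x \<otimes> y) [^] q" using x by (simp add: nat_pow_distrib)
    then show "a \<otimes> b \<in> P" using x y by (auto simp: P_def)
  qed
  define Hs where "Hs = {H. subgroup H G \<and> P \<subseteq> H \<and> H \<noteq> carrier G}"
  have "Hs \<subseteq> Pow (carrier G)" using subgroup.subset by (auto simp: Hs_def)
  then have "finite Hs" using fin by (meson finite_Pow_iff finite_subset)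
  moreover have "P \<in> Hs" using P power_image_proper[OF fin q] by (auto simp: Hs_def P_def)
  ultimately have "Max (card ` Hs) \<in> card ` Hs" by (intro Max_in) auto
  then obtain H where H: "H \<in> Hs" "card H = Max (card ` Hs)" by auto
  have max: "card K \<le> card H" if "K \<in> Hs" for K
    using that H(2) \<open>finite Hs\<close> by simp
  have subH: "subgroup H G" and PH: "P \<subseteq> H" and HneqG: "H \<noteq> carrier G" using H(1) by (auto simp: Hs_def)
  have HG: "h \<in> carrier G" if "h \<in> H" for h using subgroup.mem_carrier[OF subH that] .
  obtain x where x: "x \<in> carrier G" "x \<notin> H" using HneqG HG by blast
  define K where "K = {x [^] (i :: int) \<otimes> h | i h. h \<in> H}"
  have subK: "subgroup K G" unfolding K_def by (rule subgroup_adjoin_element[OF subH x(1)])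
  have HK: "H \<subseteq> K"
  proof
    fix h assume h: "h \<in> H"
    then have "h = x [^] (0 :: int) \<otimes> h" using HG by simp
    with h show "h \<in> K" unfolding K_def by blast
  qed
  have "x = x [^] (1 :: int) \<otimes> \<one>" using x by simp
  then have xK: "x \<in> K" unfolding K_def using subgroup.one_closed[OF subH] by blast
  have KG: "K = carrier G"
  proof (rule ccontr)
    assume "K \<noteq> carrier G"
    then have "K \<in> Hs" using subK HK PH by (auto simp: Hs_def)
    then have "card K \<le> card H" by (rule max)
    moreover have "finite K" using subgroup.subset[OF subK] fin finite_subset by blast
    ultimately have "H = K" using HK card_seteq by blast
    then show False using xK x by blast
  qed
  have xq: "x [^] int q \<in> H" using PH x(1) by (auto simp: P_def int_pow_int)
  \<comment> \<open>Otherwise Bezout expresses x through x^q and x^i, both in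
    \<open>H\<close>.\<close>
  have dvd: "int q dvd i" if i: "x [^] i \<in> H" for i :: int
  proof (rule ccontr)
    assume "\<not> int q dvd i"
    then have "coprime (int q) i" using q(1) by (intro prime_imp_coprime) auto
    then have "gcd (int q) i = 1" by simp
    then obtain u v where uv: "u * int q + v * i = 1" using bezout_int[of "int q" i] by auto
    have "x = x [^] (int q * u + i * v)" using uv x(1) by (simp add: mult.commute)
    also have "\<dots> = (x [^] int q) [^] u \<otimes> (x [^] i) [^] v"
      using x(1) by (simp add: int_pow_mult int_pow_pow)
    also have "\<dots> \<in> H"
      using xq i subgroup_int_pow_closed[OF subH] subgroup.m_closed[OF subH] by blast
    finally show False using x(2) by simp
  qed
  have "\<exists>i :: int. \<exists>h\<in>H. g = x [^] i \<otimes> h" if "g \<in> carrier G" for g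
    using that unfolding KG[symmetric] K_def by blast
  \<comment> \<open>\<open>f\<close> chooses any exponent of the coset of g; \<open>unique\<close>
    below shows that the choice is immaterial modulo q, and with it that f is additive.\<close>
  then obtain f where f: "\<And>g. g \<in> carrier G \<Longrightarrow> \<exists>h\<in>H. g = x [^] (f g :: int) \<otimes> h" by metis
  have unique: "[i = j] (mod int q)"
    if eq: "x [^] i \<otimes> h = x [^] j \<otimes> k" and hk: "h \<in> H" "k \<in> H" for i j :: int and h k
  proof -
    have "x [^] (i - j) = k \<otimes> inv h"
    proof -
      have "x [^] i = x [^] j \<otimes> k \<otimes> inv h" using eq hk HG x(1) by (metis int_pow_closed inv_solve_right m_closed)
      then have "x [^] i = x [^] j \<otimes> (k \<otimes> inv h)" using hk HG x(1) by (simp add: m_assoc)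
      then have "inv (x [^] j) \<otimes> x [^] i = k \<otimes> inv h"
        using hk HG x(1) by (metis int_pow_closed inv_closed inv_solve_left m_closed)
      then show ?thesis using x(1) by (simp add: int_pow_diff m_comm)
    qed
    then have "x [^] (i - j) \<in> H"
      using hk subgroup.m_closed[OF subH] subgroup.m_inv_closed[OF subH] by simp
    then show ?thesis using dvd by (simp add: cong_iff_dvd_diff)
  qed
  have "surj_hom_mod G (int q) f"
    unfolding surj_hom_mod_def
  proof (intro conjI ballI bexI[of _ x])
    fix a b assume ab: "a \<in> carrier G" "b \<in> carrier G"
    from f[OF ab(1)] f[OF ab(2)] f[of "a \<otimes> b"] ab obtain h k l where
      h: "h \<in> H" "a = x [^] f a \<otimes> h" and k: "k \<in> H" "b = x [^] f b \<otimes> k"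
      and l: "l \<in> H" "a \<otimes> b = x [^] f (a \<otimes> b) \<otimes> l" by blast
    have "a \<otimes> b = (x [^] f a \<otimes> h) \<otimes> (x [^] f b \<otimes> k)" using h(2) k(2) by metis
    also have "\<dots> = x [^] (f a + f b) \<otimes> (h \<otimes> k)"
      using h(1) k(1) HG x(1) by (simp add: int_pow_mult m_ac)
    finally have "x [^] f (a \<otimes> b) \<otimes> l = x [^] (f a + f b) \<otimes> (h \<otimes> k)" using l(2) by simp
    then show "[f (a \<otimes> b) = f a + f b] (mod int q)"
      using unique l(1) h(1) k(1) subgroup.m_closed[OF subH] by blast
  next
    obtain h where h: "h \<in> H" "x = x [^] f x \<otimes> h" using f x(1) by blast
    have "x [^] f x \<otimes> h = x [^] (1 :: int) \<otimes> \<one>" using h(2) x(1) by simp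
    then show "[f x = 1] (mod int q)" using unique h(1) subgroup.one_closed[OF subH] by blast
  qed (rule x(1))
  then show ?thesis by blast
qed

lemma (in group) surj_hom_mod_one:
  assumes "surj_hom_mod G w f"
  shows "[f \<one> = 0] (mod w)"
proof -
  have "[f (\<one> \<otimes> \<one>) = f \<one> + f \<one>] (mod w)" using assms unfolding surj_hom_mod_def by blast
  then show ?thesis by (simp add: cong_iff_dvd_diff)
qed

lemma (in group) surj_hom_mod_inv:
  assumes "surj_hom_mod G w f" "x \<in> carrier G"
  shows "[f (inv x) = - f x] (mod w)"
proof -
  have "[f (x \<otimes> inv x) = f x + f (inv x)] (mod w)" using assms unfolding surj_hom_mod_def by blast
  then have "[f x + f (inv x) = 0] (mod w)"
    using surj_hom_mod_one[OF assms(1)] assms(2) by (metis cong_sym cong_trans r_inv)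
  then show ?thesis by (simp add: cong_iff_dvd_diff add.commute)
qed

lemma (in group) surj_hom_mod_nat_pow:
  assumes "surj_hom_mod G w f" "x \<in> carrier G"
  shows "[f (x [^] (n :: nat)) = int n * f x] (mod w)"
proof (induction n)
  case 0
  then show ?case using surj_hom_mod_one[OF assms(1)] by simp
next
  case (Suc n)
  have "[f (x [^] n \<otimes> x) = f (x [^] n) + f x] (mod w)"
    using assms unfolding surj_hom_mod_def by blast
  also have "[f (x [^] n) + f x = int n * f x + f x] (mod w)"
    using Suc by (intro cong_add) auto
  finally show ?case by (simp add: algebra_simps)
qed

lemma (in group) surj_hom_mod_surj:
  assumes "surj_hom_mod G (int w) f" "w > 0"
  shows "\<exists>x\<in>carrier G. [f x = k] (mod int w)"
proof -
  obtain x where x: "x \<in> carrier G" "[f x = 1] (mod int w)"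
    using assms unfolding surj_hom_mod_def by blast
  have "[f (x [^] nat (k mod int w)) = int (nat (k mod int w)) * f x] (mod int w)"
    by (rule surj_hom_mod_nat_pow[OF assms(1) x(1)])
  also have "[int (nat (k mod int w)) * f x = int (nat (k mod int w)) * 1] (mod int w)"
    by (rule cong_scalar_left[OF x(2)])
  also have "[int (nat (k mod int w)) * 1 = k] (mod int w)"
    using assms(2) by (simp add: cong_def)
  finally show ?thesis using x(1) nat_pow_closed by blast
qed

text \<open>The Chinese remainder theorem: the combined map is w * f modulo u and u * g modulo
  w.\<close>

lemma (in comm_group) surj_hom_mod_combine:
  assumes f: "surj_hom_mod G (int u) f" and g: "surj_hom_mod G (int w) g"
    and uw: "coprime u w" "u > 0" "w > 0"
  shows "surj_hom_mod G (int (u * w)) (\<lambda>x. int w * f x + int u * g x)"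
proof -
  have lift: "[int w * a + int u * b = int w * a' + int u * b'] (mod int (u * w))"
    if cong: "[a = a'] (mod int u)" "[b = b'] (mod int w)" for a a' b b'
  proof -
    obtain s where "a - a' = int u * s" using cong(1) unfolding cong_iff_dvd_diff by (rule dvdE)
    moreover obtain t where "b - b' = int w * t" using cong(2) unfolding cong_iff_dvd_diff by (rule dvdE)
    moreover have "int w * a + int u * b - (int w * a' + int u * b') = int w * (a - a') + int u * (b - b')"
      by (simp add: algebra_simps)
    ultimately have "int w * a + int u * b - (int w * a' + int u * b') = int (u * w) * (s + t)"
      by (simp add: algebra_simps)
    then show ?thesis by (simp add: cong_iff_dvd_diff)
  qed
  show ?thesis
    unfolding surj_hom_mod_def
  proof (intro conjI ballI)
    fix a b assume "a \<in> carrier G" "b \<in> carrier G"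
    then have "[f (a \<otimes> b) = f a + f b] (mod int u)" "[g (a \<otimes> b) = g a + g b] (mod int w)"
      using f g unfolding surj_hom_mod_def by blast+
    from lift[OF this] show "[int w * f (a \<otimes> b) + int u * g (a \<otimes> b) =
        int w * f a + int u * g a + (int w * f b + int u * g b)] (mod int (u * w))"
      by (simp add: algebra_simps)
  next
    show "\<exists>a\<in>carrier G. [int w * f a + int u * g a = 1] (mod int (u * w))"
    proof -
      \<comment> \<open>Squares occur because the witness a^w * b^u contributes w and u once through
        its exponents, and the combined map multiplies by w and u again.\<close>
      have "coprime (int u * int u) (int w * int w)" using uw(1) by simp
      then have "gcd (int u * int u) (int w * int w) = 1" by (simp only: coprime_iff_gcd_eq_1)
      then obtain s t where st: "s * (int u * int u) + t * (int w * int w) = 1"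
        using bezout_int by metis
      obtain a where a: "a \<in> carrier G" "[f a = t] (mod int u)" using surj_hom_mod_surj[OF f uw(2)] by blast
      obtain b where b: "b \<in> carrier G" "[g b = s] (mod int w)" using surj_hom_mod_surj[OF g uw(3)] by blast
      define c where "c = a [^] w \<otimes> b [^] u"
      have "[f c = f (a [^] w) + f (b [^] u)] (mod int u)"
        using f a b unfolding surj_hom_mod_def c_def by blast
      also have "[f (a [^] w) + f (b [^] u) = int w * f a + int u * f b] (mod int u)"
        by (intro cong_add surj_hom_mod_nat_pow f a b)
      also have "[int w * f a + int u * f b = int w * t + 0] (mod int u)"
        by (intro cong_add cong_scalar_left a) (simp add: cong_0_iff)
      finally have fc: "[f c = int w * t] (mod int u)" by simp
      have "[g c = g (a [^] w) + g (b [^] u)] (mod int w)"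
        using g a b unfolding surj_hom_mod_def c_def by blast
      also have "[g (a [^] w) + g (b [^] u) = int w * g a + int u * g b] (mod int w)"
        by (intro cong_add surj_hom_mod_nat_pow g a b)
      also have "[int w * g a + int u * g b = 0 + int u * s] (mod int w)"
        by (intro cong_add cong_scalar_left b) (simp add: cong_0_iff)
      finally have gc: "[g c = int u * s] (mod int w)" by simp
      have "[int w * f c + int u * g c = int w * (int w * t) + int u * (int u * s)] (mod int (u * w))"
        by (rule lift[OF fc gc])
      also have "int w * (int w * t) + int u * (int u * s) = 1" using st by (simp add: algebra_simps)
      finally show ?thesis using a b by (auto simp: c_def intro!: bexI[of _ c])
    qed
  qed
qed

lemma (in comm_group) exists_surj_hom_mod:
  assumes fin: "finite (carrier G)" and I: "finite I" "inj_on q I"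
    and q: "\<And>i. i \<in> I \<Longrightarrow> Factorial_Ring.prime (q i) \<and> q i dvd Coset.order G"
  shows "\<exists>f. surj_hom_mod G (int (\<Prod>i\<in>I. q i)) f"
  using I q
proof (induction I rule: finite_induct)
  case empty
  show ?case by (auto simp: surj_hom_mod_def)
next
  case (insert i I)
  then obtain f where f: "surj_hom_mod G (int (\<Prod>i\<in>I. q i)) f" by auto
  obtain g where g: "surj_hom_mod G (int (q i)) g"
    using exists_surj_hom_mod_prime[OF fin] insert.prems(2)[of i] by auto
  have pos: "q j > 0" if "j \<in> insert i I" for j using insert.prems(2)[OF that] prime_gt_0_nat by blast
  have "coprime (q i) (q j)" if "j \<in> I" for j
    using that insert inj_onD[OF insert.prems(1), of i j] by (intro primes_coprime) auto
  then have "coprime (q i) (\<Prod>i\<in>I. q i)" by (intro prod_coprime_right)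
  moreover have "(\<Prod>i\<in>I. q i) > 0" using pos by (intro prod_pos) auto
  ultimately show ?case using surj_hom_mod_combine[OF g f] pos insert.hyps by auto
qed

text \<open>Translation by an element of value l - k embeds the fibre over k into the fibre over l,
  so all w fibres have the same size.\<close>

lemma (in group) card_surj_hom_mod_fibre:
  assumes fin: "finite (carrier G)" and f: "surj_hom_mod G (int w) f" and w: "w > 0"
  shows "card {x \<in> carrier G. [f x = k] (mod int w)} * w = Coset.order G"
proof -
  define F where "F k = {x \<in> carrier G. [f x = k] (mod int w)}" for k
  have le: "card (F k) \<le> card (F l)" for k l
  proof -
    obtain a where a: "a \<in> carrier G" "[f a = l - k] (mod int w)" using surj_hom_mod_surj[OF f w] by blast
    have "inj_on (\<lambda>x. x \<otimes> a) (F k)" using a by (auto simp: F_def inj_on_def)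
    moreover have "(\<lambda>x. x \<otimes> a) ` F k \<subseteq> F l"
    proof safe
      fix x assume x: "x \<in> F k"
      then have "[f (x \<otimes> a) = f x + f a] (mod int w)" using f a by (auto simp: surj_hom_mod_def F_def)
      also have "[f x + f a = k + (l - k)] (mod int w)" using x a by (intro cong_add) (auto simp: F_def)
      finally show "x \<otimes> a \<in> F l" using x a by (simp add: F_def)
    qed
    ultimately show ?thesis using fin by (intro card_inj_on_le) (auto simp: F_def)
  qed
  then have eq: "card (F l) = card (F k)" for l by (simp add: le_antisym)
  have "carrier G = (\<Union>l\<in>{..<w}. F (int l))"
  proof safe
    fix x assume x: "x \<in> carrier G"
    have "x \<in> F (int (nat (f x mod int w)))" using x w by (simp add: F_def cong_def)
    moreover have "nat (f x mod int w) < w" using w by (simp add: nat_less_iff)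
    ultimately show "x \<in> (\<Union>l\<in>{..<w}. F (int l))" by blast
  qed (auto simp: F_def)
  then have "Coset.order G = card (\<Union>l\<in>{..<w}. F (int l))" by (simp add: Coset.order_def)
  also have "\<dots> = (\<Sum>l\<in>{..<w}. card (F (int l)))"
  proof (rule card_UN_disjoint)
    show "\<forall>i\<in>{..<w}. \<forall>j\<in>{..<w}. i \<noteq> j \<longrightarrow> F (int i) \<inter> F (int j) = {}"
    proof (intro ballI impI)
      fix i j assume "i \<in> {..<w}" "j \<in> {..<w}" "i \<noteq> j"
      then have "\<not> [int i = int j] (mod int w)" by (simp add: cong_int_iff cong_def)
      then have "x \<notin> F (int j)" if "x \<in> F (int i)" for x
        using that unfolding F_def by (metis (mono_tags, lifting) cong_sym cong_trans mem_Collect_eq)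
      then show "F (int i) \<inter> F (int j) = {}" by blast
    qed
  qed (use fin in \<open>auto simp: F_def\<close>)
  also have "\<dots> = (\<Sum>l\<in>{..<w}. card (F k))" by (rule sum.cong[OF refl eq])
  also have "\<dots> = w * card (F k)" by simp
  finally show ?thesis by (simp add: F_def mult.commute)
qed

section \<open>Differences of periodic functions\<close>

text \<open>Iterated backward differences, that is, convolution with the product of the 1 - X^s.
  Under the Fourier transform they become multiplication by the factors 1 - z^s.\<close>

definition shift_diffs :: "int list \<Rightarrow> (int \<Rightarrow> int) \<Rightarrow> int \<Rightarrow> int" where
  "shift_diffs ss F = foldr (\<lambda>s F k. F k - F (k - s)) ss F"

lemma shift_diffs_simps [simp]:
  "shift_diffs [] F = F"
  "shift_diffs (s # ss) F k = shift_diffs ss F k - shift_diffs ss F (k - s)"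
  by (simp_all add: shift_diffs_def)

lemma shift_diffs_linear:
  "shift_diffs ss (\<lambda>k. F k - c * H k) k = shift_diffs ss F k - c * shift_diffs ss H k"
  by (induction ss arbitrary: k) (simp_all add: algebra_simps)

lemma shift_diffs_periodic:
  assumes "\<And>k. F (k + w) = F k"
  shows "shift_diffs ss F (k + w) = shift_diffs ss F k"
proof (induction ss arbitrary: k)
  case (Cons s ss)
  have "k + w - s = (k - s) + w" by simp
  then show ?case using Cons[of k] Cons[of "k - s"] by (simp only: shift_diffs_simps)
qed (simp add: assms)

text \<open>The difference of two numbers in [0, M] has absolute value at most M; only the later
  differences double the bound. The induction therefore starts at the one-element list.\<close>

lemma abs_shift_diffs_le:
  assumes F: "\<And>k. 0 \<le> F k \<and> F k \<le> M" and "ss \<noteq> []"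
  shows "\<bar>shift_diffs ss F k\<bar> \<le> 2 ^ (length ss - 1) * M"
  using assms(2)
proof (induction ss arbitrary: k)
  case (Cons s ss)
  show ?case
  proof (cases ss)
    case Nil
    then show ?thesis using F[of k] F[of "k - s"] by (simp add: abs_le_iff)
  next
    case (Cons s' ss')
    then have "\<bar>shift_diffs ss F k\<bar> \<le> 2 ^ (length ss - 1) * M"
      "\<bar>shift_diffs ss F (k - s)\<bar> \<le> 2 ^ (length ss - 1) * M" using Cons.IH by auto
    moreover have "(2 :: int) ^ (length (s # ss) - 1) = 2 * 2 ^ (length ss - 1)"
      using \<open>ss = s' # ss'\<close> by simp
    ultimately show ?thesis by simp
  qed
qed simp

text \<open>One Fourier coefficient of a function on Z/w. Integer arguments and integer powers of z
  let shifts in both directions be handled alike.\<close>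

definition periodic_dft :: "nat \<Rightarrow> complex \<Rightarrow> (int \<Rightarrow> int) \<Rightarrow> complex" where
  "periodic_dft w z F = (\<Sum>k\<in>{0..<int w}. of_int (F k) * z powi k)"

lemma periodic_dft_nat: "periodic_dft w z F = (\<Sum>k<w. of_int (F (int k)) * z ^ k)"
proof -
  have "(\<Sum>k\<in>int ` {0..<w}. of_int (F k) * z powi k) = (\<Sum>k<w. of_int (F (int k)) * z ^ k)"
    by (subst sum.reindex) (simp_all add: lessThan_atLeast0)
  then show ?thesis unfolding periodic_dft_def image_int_atLeastLessThan by simp
qed

lemma periodic_mod:
  fixes F :: "int \<Rightarrow> 'a" and k w :: int
  assumes "\<And>k. F (k + w) = F k"
  shows "F (k mod w) = F k"
proof -
  have step: "F (k + int n * w) = F k" for n k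
  proof (induction n)
    case (Suc n)
    have "F (k + int (Suc n) * w) = F ((k + int n * w) + w)" by (simp add: algebra_simps)
    also have "\<dots> = F k" using assms Suc by simp
    finally show ?case .
  qed simp
  have "k = k mod w + (k div w) * w" by simp
  show ?thesis
  proof (cases "k div w \<ge> 0")
    case True
    then have "k = k mod w + int (nat (k div w)) * w" by simp
    then show ?thesis using step[of "k mod w" "nat (k div w)"] by metis
  next
    case False
    have "k mod w = k - (k div w) * w" by (simp add: minus_div_mult_eq_mod)
    also have "\<dots> = k + int (nat (- (k div w))) * w" using False by (simp add: algebra_simps)
    finally show ?thesis using step[of k "nat (- (k div w))"] by metis
  qed
qed

lemma root_of_unity_powi_cong:
  assumes z: "z ^ w = (1 :: complex)" "w > 0" and ab: "[a = b] (mod int w)"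
  shows "z powi a = z powi b"
proof -
  have z0: "z \<noteq> 0" using z by (metis power_0_left zero_neq_one less_numeral_extra(3))
  obtain c where "a - b = int w * c" using ab unfolding cong_iff_dvd_diff by (rule dvdE)
  then have "a = b + int w * c" by simp
  then have "z powi a = z powi b * (z powi int w) powi c" using z0 by (simp add: power_int_add power_int_mult)
  then show ?thesis using z by simp
qed

lemma sum_periodic_shift:
  fixes g :: "int \<Rightarrow> 'a :: comm_monoid_add"
  assumes w: "w > 0" and g: "\<And>k. g (k + w) = g k"
  shows "(\<Sum>k\<in>{0..<w}. g (k - s)) = (\<Sum>k\<in>{0..<w}. g k)"
proof -
  have inj: "inj_on (\<lambda>k. (k - s) mod w) {0..<w}"
  proof (rule inj_onI)
    fix i j assume ij: "i \<in> {0..<w}" "j \<in> {0..<w}" "(i - s) mod w = (j - s) mod w"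
    then have "w dvd (i - s) - (j - s)" by (simp only: mod_eq_dvd_iff)
    then have "i mod w = j mod w" by (simp add: mod_eq_dvd_iff)
    then show "i = j" using ij by simp
  qed
  moreover have "(\<lambda>k. (k - s) mod w) ` {0..<w} = {0..<w}"
    by (rule endo_inj_surj) (use w inj in auto)
  ultimately have "bij_betw (\<lambda>k. (k - s) mod w) {0..<w} {0..<w}" by (simp add: bij_betw_def)
  then have "(\<Sum>k\<in>{0..<w}. g ((k - s) mod w)) = (\<Sum>k\<in>{0..<w}. g k)" by (rule sum.reindex_bij_betw)
  then show ?thesis by (simp only: periodic_mod[of g, OF g])
qed

lemma periodic_dft_shift:
  assumes z: "z ^ w = 1" "w > 0" and F: "\<And>k. F (k + int w) = F k"
  shows "periodic_dft w z (\<lambda>k. F (k - s)) = z powi s * periodic_dft w z F"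
proof -
  have z0: "z \<noteq> 0" using z by (metis power_0_left zero_neq_one less_numeral_extra(3))
  define g where "g k = of_int (F k) * z powi k" for k
  have g: "g (k + int w) = g k" for k
    unfolding g_def using F root_of_unity_powi_cong[OF z, of "k + int w" k] by (simp add: cong_def)
  have "periodic_dft w z (\<lambda>k. F (k - s)) = (\<Sum>k\<in>{0..<int w}. z powi s * g (k - s))"
    unfolding periodic_dft_def g_def using z0
    by (intro sum.cong) (simp_all add: power_int_diff)
  also have "\<dots> = z powi s * (\<Sum>k\<in>{0..<int w}. g (k - s))" by (simp add: sum_distrib_left)
  also have "(\<Sum>k\<in>{0..<int w}. g (k - s)) = periodic_dft w z F"
    using sum_periodic_shift[of "int w" g, OF _ g] z(2) unfolding periodic_dft_def g_def by simp
  finally show ?thesis .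
qed

lemma periodic_dft_shift_diffs:
  assumes z: "z ^ w = 1" "w > 0" and F: "\<And>k. F (k + int w) = F k"
  shows "periodic_dft w z (shift_diffs ss F) = (\<Prod>s\<leftarrow>ss. 1 - z powi s) * periodic_dft w z F"
proof (induction ss)
  case (Cons s ss)
  have periodic: "shift_diffs ss F (k + int w) = shift_diffs ss F k" for k
    by (rule shift_diffs_periodic) (rule F)
  have "periodic_dft w z (shift_diffs (s # ss) F) =
      periodic_dft w z (shift_diffs ss F) - periodic_dft w z (\<lambda>k. shift_diffs ss F (k - s))"
    by (simp add: periodic_dft_def sum_subtractf algebra_simps)
  also have "\<dots> = (1 - z powi s) * periodic_dft w z (shift_diffs ss F)"
    by (subst periodic_dft_shift[where F = "shift_diffs ss F", OF z periodic]) (simp add: algebra_simps)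
  finally show ?case using Cons by (simp del: shift_diffs_simps add: mult.assoc)
qed simp

text \<open>Injectivity of the Fourier transform: a polynomial of degree below w cannot have the w
  distinct powers of z as roots unless it is zero.\<close>

lemma periodic_dft_eq_0_imp:
  assumes z: "w > 0" "inj_on (\<lambda>k. z ^ k) {..<w}"
    and dft: "\<And>c. c < w \<Longrightarrow> periodic_dft w (z ^ c) F = 0" and k: "k < w"
  shows "F (int k) = 0"
proof -
  define P where "P = (\<Sum>k<w. Polynomial.monom (complex_of_int (F (int k))) k)"
  have coeff: "Polynomial.coeff P i = (if i < w then of_int (F (int i)) else 0)" for i
    unfolding P_def by (simp add: coeff_sum if_distrib cong: if_cong)
  have "P = 0"
  proof (rule ccontr)
    assume "P \<noteq> 0"
    have deg: "degree P < w"
      using \<open>P \<noteq> 0\<close> coeff[of "degree P"] by (metis leading_coeff_0_iff)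
    have "(\<lambda>k. z ^ k) ` {..<w} \<subseteq> {x. poly P x = 0}"
    proof safe
      fix c assume "c < w"
      then show "poly P (z ^ c) = 0" using dft[of c]
        by (simp add: P_def periodic_dft_nat poly_sum poly_monom)
    qed
    then have "card ((\<lambda>k. z ^ k) ` {..<w}) \<le> card {x. poly P x = 0}"
      by (rule card_mono[OF poly_roots_finite[OF \<open>P \<noteq> 0\<close>]])
    also have "\<dots> \<le> degree P" by (rule card_poly_roots_bound[OF \<open>P \<noteq> 0\<close>])
    finally show False using deg z(2) by (simp add: card_image)
  qed
  then show ?thesis using coeff[of k] k by simp
qed

text \<open>A relation at one primitive root of unity holds at all of them, and at the imprimitive ones
  the factors \<open>1 - z ^ (w / q)\<close> vanish; hence the differences of \<open>F\<close> along \<open>w / q\<close> vanish.\<close>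
lemma shift_diffs_eq_0:
  assumes z: "z ^ w = 1" "w > 0" "inj_on (\<lambda>k. z ^ k) {..<w}"
    and F: "\<And>k. F (k + int w) = F k" and dft: "periodic_dft w z F = 0"
    and Q: "set Q = prime_factors w"
  shows "shift_diffs (map (\<lambda>q. int (w div q)) Q) F k = 0"
proof -
  let ?T = "shift_diffs (map (\<lambda>q. int (w div q)) Q) F"
  have T: "?T (k + int w) = ?T k" for k
    by (rule shift_diffs_periodic) (rule F)
  define h :: "int poly" where "h = (\<Sum>k<w. Polynomial.monom (F (int k)) k)"
  have h: "poly (of_int_poly h) y = periodic_dft w y F" for y
  proof -
    have "Polynomial.coeff h i = (if i < w then F (int i) else 0)" for i
      unfolding h_def by (simp add: coeff_sum if_distrib cong: if_cong)
    then have "of_int_poly h = (\<Sum>k<w. Polynomial.monom (complex_of_int (F (int k))) k)"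
      by (intro poly_eqI) (simp add: coeff_sum coeff_map_poly if_distrib cong: if_cong)
    then show ?thesis by (simp add: periodic_dft_nat poly_sum poly_monom)
  qed
  have "periodic_dft w (z ^ c) ?T = 0" if "c < w" for c
  proof -
    have zc: "(z ^ c) ^ w = 1" using z(1) by (metis mult.commute power_mult power_one)
    have "(\<Prod>s\<leftarrow>map (\<lambda>q. int (w div q)) Q. 1 - (z ^ c) powi s) * periodic_dft w (z ^ c) F = 0"
    proof (cases "coprime c w")
      case True
      then have "periodic_dft w (z ^ c) F = 0"
        using int_poly_root_of_unity_power[OF z(1,2), of h c] dft by (simp add: h)
      then show ?thesis by simp
    next
      case False
      then obtain q where q: "Factorial_Ring.prime q" "q dvd c" "q dvd w"
        using z(2) by (metis coprime_iff_gcd_eq_1 gcd_nat.bounded_iff prime_factor_nat)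
      then have "q \<in> set Q" using Q z(2) by (simp add: prime_factors_dvd)
      obtain d where d: "c = q * d" using q(2) by (rule dvdE)
      have "(z ^ c) ^ (w div q) = z ^ (q * (w div q) * d)" by (simp add: d mult_ac flip: power_mult)
      also have "\<dots> = 1" using q(3) z(1) by (simp add: power_mult)
      finally have "1 - (z ^ c) powi int (w div q) = 0" by simp
      with \<open>q \<in> set Q\<close> have "0 \<in> set (map (\<lambda>s. 1 - (z ^ c) powi s) (map (\<lambda>q. int (w div q)) Q))"
        by (auto simp: image_iff intro!: bexI[of _ q])
      then show ?thesis by (simp add: prod_list_zero_iff)
    qed
    then show ?thesis by (simp only: periodic_dft_shift_diffs[where F = F, OF zc z(2) F])
  qed
  then have "?T (int (nat (k mod int w))) = 0"
    using z by (intro periodic_dft_eq_0_imp[OF z(2,3)]) (auto simp: nat_less_iff)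
  then have "?T (k mod int w) = 0" using z(2) by simp
  then show ?thesis using periodic_mod[of ?T, OF T] by simp
qed

section \<open>Character sums of external difference families\<close>

lemma sum_mset_image_eq_sum_count:
  fixes h :: "'a \<Rightarrow> 'b :: comm_semiring_1"
  assumes "finite A" "set_mset M \<subseteq> A"
  shows "(\<Sum>x\<in>#M. h x) = (\<Sum>x\<in>A. of_nat (count M x) * h x)"
  using assms(2)
proof (induction M)
  case (add a M)
  have "(\<Sum>x\<in>A. of_nat (count (add_mset a M) x) * h x)
      = (\<Sum>x\<in>A. (if x = a then h x else 0) + of_nat (count M x) * h x)"
    by (intro sum.cong) (auto simp: algebra_simps)
  also have "\<dots> = h a + (\<Sum>x\<in>A. of_nat (count M x) * h x)"
    using add.prems assms(1) by (simp add: sum.distrib)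
  finally show ?case using add by simp
qed simp

lemma sum_mset_image_sum:
  fixes h :: "'a \<Rightarrow> 'b :: comm_monoid_add"
  shows "(\<Sum>x\<in>#(\<Sum>l\<in>A. N l). h x) = (\<Sum>l\<in>A. \<Sum>x\<in>#N l. h x)"
  by (induction A rule: infinite_finite_induct) auto

locale root_of_unity_character = comm_group G for G (structure) +
  fixes w :: nat and f :: "'a \<Rightarrow> int" and z :: complex
  assumes fin: "finite (carrier G)"
    and hom: "surj_hom_mod G (int w) f"
    and z: "z ^ w = 1" "w > 0" "inj_on (\<lambda>k. z ^ k) {..<w}"
begin

definition char :: "'a \<Rightarrow> complex" where "char x = z powi (f x)"

lemma z_nonzero: "z \<noteq> 0"
  using z by (metis power_0_left zero_neq_one less_numeral_extra(3))

lemma char_mult: "x \<in> carrier G \<Longrightarrow> y \<in> carrier G \<Longrightarrow> char (x \<otimes> y) = char x * char y"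
  unfolding char_def using hom z_nonzero root_of_unity_powi_cong[OF z(1,2), of "f (x \<otimes> y)" "f x + f y"]
  by (simp add: surj_hom_mod_def power_int_add)

lemma cnj_char: "cnj (char x) = z powi (- f x)"
proof -
  have "cnj z = inverse z" using cnj_root_of_unity(2)[OF z(1,2)] z_nonzero by (simp add: field_simps)
  then show ?thesis by (simp add: char_def power_int_minus power_int_inverse)
qed

lemma char_inv: "x \<in> carrier G \<Longrightarrow> char (inv x) = cnj (char x)"
  unfolding cnj_char unfolding char_def
  by (rule root_of_unity_powi_cong[OF z(1,2) surj_hom_mod_inv[OF hom]])

lemma char_one: "char \<one> = 1"
  unfolding char_def using root_of_unity_powi_cong[OF z(1,2) surj_hom_mod_one[OF hom]] by simp

lemma char_in_int_adjoin: "char x \<in> int_adjoin z"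
proof -
  have "char x = z powi (int (nat (f x mod int w)))"
    unfolding char_def using z(2) by (intro root_of_unity_powi_cong[OF z(1,2)]) (simp add: cong_def)
  then have "char x = z ^ nat (f x mod int w)" by (simp only: power_int_of_nat)
  then show ?thesis by auto
qed

lemma sum_char:
  assumes "w > 1"
  shows "(\<Sum>x\<in>carrier G. char x) = 0"
proof -
  obtain a where a: "a \<in> carrier G" "[f a = 1] (mod int w)" using hom unfolding surj_hom_mod_def by blast
  have "char a = z" unfolding char_def using root_of_unity_powi_cong[OF z(1,2) a(2)] by simp
  moreover have "z \<noteq> 1" using inj_onD[OF z(3), of 0 1] assms by auto
  ultimately have "char a \<noteq> 1" by simp
  have "(\<Sum>x\<in>carrier G. char x) = (\<Sum>x\<in>carrier G. char (a \<otimes> x))"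
  proof (rule sum.reindex_bij_betw[symmetric])
    have inj: "inj_on (\<lambda>x. a \<otimes> x) (carrier G)" using a(1) by (auto simp: inj_on_def)
    moreover have "(\<lambda>x. a \<otimes> x) ` carrier G = carrier G"
      by (rule endo_inj_surj[OF fin _ inj]) (use a(1) in auto)
    ultimately show "bij_betw (\<lambda>x. a \<otimes> x) (carrier G) (carrier G)" by (simp add: bij_betw_def)
  qed
  also have "\<dots> = char a * (\<Sum>x\<in>carrier G. char x)"
    unfolding sum_distrib_left by (rule sum.cong) (use a(1) char_mult in auto)
  finally have "(1 - char a) * (\<Sum>x\<in>carrier G. char x) = 0" by (simp add: algebra_simps)
  then show ?thesis using \<open>char a \<noteq> 1\<close> by simp
qed

text \<open>Sum the character over the multiset of external differences. Counting gives lam times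
  the sum over the non-identity elements, which is -1 because the full character sum vanishes;
  multiplicativity gives the product on the left.\<close>

lemma SEDF_character_equation:
  assumes D: "is_SEDF G v m k lam D" and j: "j \<in> {1..m}" and w: "w > 1"
  shows "(\<Sum>l\<in>{1..m} - {j}. \<Sum>x\<in>D l. char x) * cnj (\<Sum>x\<in>D j. char x) = - of_nat lam"
proof -
  let ?M = "external_differences G m D j"
  have sub: "D l \<subseteq> carrier G" if "l \<in> {1..m}" for l using D that unfolding is_SEDF_def by blast
  then have finD: "finite (D l)" if "l \<in> {1..m}" for l using that fin finite_subset by blast
  have count: "count ?M g = lam" if "g \<in> carrier G - {\<one>}" for g
    using D j that unfolding is_SEDF_def by blast
  have "\<one> \<notin># ?M" using D j unfolding is_SEDF_def by blast
  then have count1: "count ?M \<one> = 0" by (simp add: not_in_iff)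
  have "set_mset ?M \<subseteq> carrier G"
  proof
    fix g assume "g \<in># ?M"
    then have "g \<in> (\<Union>l\<in>{1..m} - {j}. set_mset (image_mset (\<lambda>(x, y). x \<otimes> inv y) (mset_set (D l \<times> D j))))"
      unfolding external_differences_def by (simp only: set_mset_sum finite_Diff finite_atLeastAtMost)
    then obtain l where l: "l \<in> {1..m} - {j}"
      "g \<in># image_mset (\<lambda>(x, y). x \<otimes> inv y) (mset_set (D l \<times> D j))" by (rule UN_E)
    then obtain x y where "x \<in> D l" "y \<in> D j" "g = x \<otimes> inv y" using finD j by auto
    then show "g \<in> carrier G" using sub l(1) j by (metis DiffD1 inv_closed m_closed subsetD)
  qed
  then have "(\<Sum>g\<in>#?M. char g) = (\<Sum>g\<in>carrier G. of_nat (count ?M g) * char g)"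
    by (rule sum_mset_image_eq_sum_count[OF fin])
  also have "\<dots> = (\<Sum>g\<in>carrier G. of_nat lam * char g - (if g = \<one> then of_nat lam else 0))"
    by (rule sum.cong) (use count count1 char_one in auto)
  also have "\<dots> = of_nat lam * (\<Sum>g\<in>carrier G. char g) - of_nat lam"
    using fin by (simp add: sum_subtractf sum_distrib_left)
  also have "\<dots> = - of_nat lam" by (simp add: sum_char[OF w])
  finally have sum1: "(\<Sum>g\<in>#?M. char g) = - of_nat lam" .
  have "(\<Sum>g\<in>#?M. char g) = (\<Sum>l\<in>{1..m} - {j}. \<Sum>g\<in>#mset_set (D l \<times> D j). char (case g of (x, y) \<Rightarrow> x \<otimes> inv y))"
    unfolding external_differences_def sum_mset_image_sum by (simp add: image_mset.compositionality o_def)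
  also have "\<dots> = (\<Sum>l\<in>{1..m} - {j}. \<Sum>(x, y)\<in>D l \<times> D j. char (x \<otimes> inv y))"
    by (simp add: sum_unfold_sum_mset case_prod_unfold)
  also have "\<dots> = (\<Sum>l\<in>{1..m} - {j}. (\<Sum>x\<in>D l. char x) * cnj (\<Sum>y\<in>D j. char y))"
  proof (rule sum.cong)
    fix l assume "l \<in> {1..m} - {j}"
    then have "D l \<subseteq> carrier G" "D j \<subseteq> carrier G" using sub j by auto
    then have "(\<Sum>(x, y)\<in>D l \<times> D j. char (x \<otimes> inv y)) = (\<Sum>(x, y)\<in>D l \<times> D j. char x * cnj (char y))"
      by (intro sum.cong) (auto simp: char_mult char_inv subset_iff)
    then show "(\<Sum>(x, y)\<in>D l \<times> D j. char (x \<otimes> inv y)) = (\<Sum>x\<in>D l. char x) * cnj (\<Sum>y\<in>D j. char y)"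
      by (simp add: sum_product sum.cartesian_product)
  qed simp
  finally show ?thesis using sum1 by (simp add: sum_distrib_right)
qed

end

text \<open>The squared norms \<open>N j\<close> all satisfy \<open>N\<^sup>2 - (2 lam + s) N + lam\<^sup>2 = 0\<close> with
  \<open>s = \<bar>S\<bar>\<^sup>2\<close>. As they sum to \<open>m lam + s\<close>, for \<open>m > 2\<close> the discriminant is a
  rational multiple of \<open>s\<close> and both roots occur, so \<open>s\<close> and both roots are rational.\<close>
lemma character_norms_rational:
  fixes X :: "nat \<Rightarrow> complex"
  assumes m: "m > 2" and lam: "lam > 0"
    and X: "\<And>j. j \<in> {1..m} \<Longrightarrow> (\<Sum>l\<in>{1..m} - {j}. X l) * cnj (X j) = - of_nat lam"
  shows "\<exists>i\<in>{1..m}. \<exists>j\<in>{1..m}. (cmod (X i))\<^sup>2 \<in> \<rat> \<and> (cmod (X j))\<^sup>2 \<in> \<rat> \<and>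
    (cmod (X i))\<^sup>2 * (cmod (X j))\<^sup>2 = (real lam)\<^sup>2 \<and> (cmod (X j))\<^sup>2 \<ge> real lam"
proof -
  define S where "S = (\<Sum>l\<in>{1..m}. X l)"
  define N where "N j = (cmod (X j))\<^sup>2" for j
  define s where "s = (cmod S)\<^sup>2"
  have SX: "S * cnj (X j) = of_real (N j - lam)" if "j \<in> {1..m}" for j
  proof -
    have "S = (\<Sum>l\<in>{1..m} - {j}. X l) + X j" unfolding S_def using that by (simp add: sum.remove)
    then have "S * cnj (X j) = - of_nat lam + X j * cnj (X j)" using X[OF that] by (simp add: distrib_right)
    then show ?thesis by (simp add: N_def complex_norm_square del: of_real_power)
  qed
  have quad: "s * N j = (N j - lam)\<^sup>2" if "j \<in> {1..m}" for j
  proof -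
    have "(cmod (S * cnj (X j)))\<^sup>2 = (N j - lam)\<^sup>2"
      by (simp only: SX[OF that] norm_of_real power2_abs)
    then show ?thesis by (simp add: s_def N_def norm_mult power_mult_distrib)
  qed
  have one: "1 \<in> {1..m}" using m by simp
  show ?thesis
  \<comment> \<open>If \<open>S\<close> vanishes, the quadratic equation degenerates: all squared
    norms equal lam and one index plays both roles.\<close>
  proof (cases "S = 0")
    case True
    then have "N j = lam" if "j \<in> {1..m}" for j using quad[OF that] by (simp add: s_def)
    then have "N 1 = lam" using one by simp
    then show ?thesis using one unfolding N_def by (intro bexI[of _ 1] conjI) (auto simp: power2_eq_square)
  next
    case False
    then have s: "s > 0" by (simp add: s_def)
    have "complex_of_real (\<Sum>j\<in>{1..m}. N j - lam) = (\<Sum>j\<in>{1..m}. S * cnj (X j))"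
      unfolding of_real_sum by (rule sum.cong) (simp_all add: SX)
    also have "\<dots> = S * cnj S" by (simp add: S_def sum_distrib_left)
    also have "\<dots> = of_real s" by (simp add: s_def complex_norm_square del: of_real_power)
    finally have "(\<Sum>j\<in>{1..m}. N j - lam) = s" by (simp only: of_real_eq_iff)
    then have sumN: "(\<Sum>j\<in>{1..m}. N j) = m * lam + s" by (simp add: sum_subtractf)
    define d where "d = sqrt (s\<^sup>2 + 4 * lam * s)"
    define Np where "Np = lam + s / 2 + d / 2"
    define Nm where "Nm = lam + s / 2 - d / 2"
    have d2: "d\<^sup>2 = s\<^sup>2 + 4 * lam * s" unfolding d_def using s by simp
    have "s\<^sup>2 < d\<^sup>2" unfolding d2 using s lam by simp
    moreover have "d \<ge> 0" unfolding d_def using s by simp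
    ultimately have ds: "d > s" by (rule power_less_imp_less_base)
    have prod: "Nm * Np = (real lam)\<^sup>2"
    proof -
      have "Nm * Np = (lam + s / 2)\<^sup>2 - d\<^sup>2 / 4" by (simp add: Np_def Nm_def power2_eq_square field_simps)
      then show ?thesis unfolding d2 by (simp add: power2_eq_square field_simps)
    qed
    have roots: "N j = Np \<or> N j = Nm" if "j \<in> {1..m}" for j
    proof -
      have "(N j - Np) * (N j - Nm) = (N j)\<^sup>2 - (2 * lam + s) * N j + Nm * Np"
        by (simp add: Np_def Nm_def power2_eq_square field_simps)
      also have "\<dots> = (N j - lam)\<^sup>2 - s * N j" unfolding prod by (simp add: power2_eq_square field_simps)
      also have "\<dots> = 0" using quad[OF that] by simp
      finally show ?thesis by simp
    qed
    define P where "P = {j \<in> {1..m}. N j = Np}"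
    define a where "a = card P"
    have P: "P \<subseteq> {1..m}" "finite P" by (auto simp: P_def)
    have am: "a \<le> m" unfolding a_def using card_mono[OF _ P(1)] by simp
    have "(\<Sum>j\<in>{1..m}. N j) = (\<Sum>j\<in>{1..m} - P. N j) + (\<Sum>j\<in>P. N j)"
      using P by (simp add: sum.subset_diff)
    also have "(\<Sum>j\<in>P. N j) = a * Np" by (simp add: P_def a_def)
    also have "(\<Sum>j\<in>{1..m} - P. N j) = (\<Sum>j\<in>{1..m} - P. Nm)"
      by (rule sum.cong) (use roots in \<open>auto simp: P_def\<close>)
    also have "\<dots> = (real m - a) * Nm" using P am by (simp add: card_Diff_subset a_def of_nat_diff)
    finally have "m * lam + s = (real m - a) * Nm + a * Np" using sumN by simp
    \<comment> \<open>Counting the \<open>a\<close> indices at the larger root in the sum of all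
      \<open>N j\<close> ties d to s. For m > 2 the right side is positive, so 2 * a < m; and a = 0
      is impossible because d > s. Hence both roots occur.\<close>
    then have eq: "(real m - 2 * a) * d = (real m - 2) * s"
      by (simp add: Np_def Nm_def field_simps)
    have "(real m - 2 * a) * d > 0" unfolding eq using m s by simp
    then have ma: "real m - 2 * a > 0" using ds s by (simp add: zero_less_mult_iff)
    have a0: "a > 0"
    proof (rule ccontr)
      assume "\<not> a > 0"
      then have "real m * d = (real m - 2) * s" using eq by simp
      moreover have "(real m - 2) * s < real m * s" using s by simp
      moreover have "real m * s < real m * d" using ds m by simp
      ultimately show False by linarith
    qed
    \<comment> \<open>\<beta> is the rational ratio d / s. Put into d^2 = s^2 + 4 * lam * s, it
      leaves an equation linear in s with rational coefficients.\<close>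
    define \<beta> where "\<beta> = (real m - 2) / (real m - 2 * a)"
    have \<beta>Q: "\<beta> \<in> \<rat>" unfolding \<beta>_def by (intro Rats_divide Rats_diff Rats_mult) auto
    have d\<beta>: "d = \<beta> * s" using eq ma by (simp add: \<beta>_def field_simps)
    have "\<beta>\<^sup>2 * s * s = (s + 4 * lam) * s" using d2 unfolding d\<beta> by (simp add: power2_eq_square algebra_simps)
    then have "\<beta>\<^sup>2 * s = s + 4 * lam" using s by simp
    then have "(\<beta>\<^sup>2 - 1) * s = 4 * lam" by (simp add: algebra_simps)
    moreover from this have "\<beta>\<^sup>2 - 1 \<noteq> 0" using lam by auto
    ultimately have "s = 4 * lam / (\<beta>\<^sup>2 - 1)" by (simp add: field_simps)
    moreover have "4 * lam / (\<beta>\<^sup>2 - 1) \<in> \<rat>" using \<beta>Q by (intro Rats_divide Rats_diff Rats_mult Rats_power) auto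
    ultimately have sQ: "s \<in> \<rat>" by simp
    then have dQ: "d \<in> \<rat>" using \<beta>Q d\<beta> by simp
    have NQ: "Np \<in> \<rat>" "Nm \<in> \<rat>" unfolding Np_def Nm_def using sQ dQ
      by (intro Rats_add Rats_diff Rats_divide; simp)+
    obtain j where j: "j \<in> {1..m}" "N j = Np" using a0 unfolding a_def P_def by (metis (mono_tags, lifting) card_gt_0_iff ex_in_conv mem_Collect_eq)
    have "P \<noteq> {1..m}" using ma a0 by (auto simp: a_def)
    then obtain i where "i \<in> {1..m}" "i \<notin> P" using P by blast
    then have i: "i \<in> {1..m}" "N i = Nm" using roots by (auto simp: P_def)
    have "Np \<ge> lam" using ds s by (simp add: Np_def)
    then show ?thesis using i j NQ prod unfolding N_def by (intro bexI[of _ i] bexI[of _ j]) auto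
  qed
qed

section \<open>From divisible character sums to vanishing ones, and the common core of the three
  cases\<close>

lemma primitive_root_of_unity:
  assumes "w > 0"
  shows "cis (2 * pi / real w) ^ w = 1" "inj_on (\<lambda>k. cis (2 * pi / real w) ^ k) {..<w}"
proof -
  have pow: "cis (2 * pi / real w) ^ k = cis (2 * pi * real k / real w)" for k
    unfolding Complex.DeMoivre by (simp add: mult_ac)
  show "cis (2 * pi / real w) ^ w = 1" using pow[of w] assms by simp
  from pow show "inj_on (\<lambda>k. cis (2 * pi / real w) ^ k) {..<w}"
    using Complex.bij_betw_roots_unity[OF assms] by (simp add: bij_betw_def)
qed

lemma int_adjoin_rational_norm:
  assumes z: "z ^ w = 1" "w > 0" and x: "x \<in> int_adjoin z" and Q: "(cmod x)\<^sup>2 \<in> \<rat>"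
  shows "\<exists>n :: nat. (cmod x)\<^sup>2 = real n"
proof -
  from Q obtain a b :: int where ab: "(cmod x)\<^sup>2 = of_int a / of_int b"
    by (auto simp: Rats_eq_int_div_int)
  have eq: "x * cnj x = of_real ((cmod x)\<^sup>2)" by (rule complex_norm_square[symmetric])
  then have "x * cnj x = of_int a / of_int b" unfolding ab by simp
  then have "x * cnj x \<in> \<rat>" by simp
  moreover have "x * cnj x \<in> int_adjoin z" using x int_adjoin_cnj[OF z] by blast
  ultimately have "x * cnj x \<in> \<int>" using int_adjoin_rational_is_int[OF z] by blast
  then obtain n where "x * cnj x = of_int n" by (rule Ints_cases)
  then have "complex_of_real ((cmod x)\<^sup>2) = complex_of_real (of_int n)" using eq by simp
  then have n: "(cmod x)\<^sup>2 = of_int n" by (simp only: of_real_eq_iff)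
  then have "n \<ge> 0" by (metis of_int_0_le_iff zero_le_power2)
  then have "(cmod x)\<^sup>2 = real (nat n)" using n by simp
  then show ?thesis ..
qed

lemma (in root_of_unity_character) periodic_dft_fibre_card:
  assumes "finite A"
  shows "periodic_dft w z (\<lambda>k. int (card {x \<in> A. [f x = k] (mod int w)})) = (\<Sum>x\<in>A. char x)"
proof -
  have "(\<Sum>x\<in>A. char x) = (\<Sum>x\<in>A. z powi (f x mod int w))"
    unfolding char_def by (rule sum.cong) (auto intro!: root_of_unity_powi_cong[OF z(1,2)] simp: cong_def)
  also have "\<dots> = (\<Sum>k\<in>{0..<int w}. \<Sum>x | x \<in> A \<and> f x mod int w = k. z powi (f x mod int w))"
    by (rule sum.group[symmetric]) (use assms z(2) in auto)
  also have "\<dots> = (\<Sum>k\<in>{0..<int w}. of_int (int (card {x \<in> A. [f x = k] (mod int w)})) * z powi k)"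
  proof (rule sum.cong)
    fix k assume k: "k \<in> {0..<int w}"
    have "(\<Sum>x | x \<in> A \<and> f x mod int w = k. z powi (f x mod int w)) = (\<Sum>x | x \<in> A \<and> f x mod int w = k. z powi k)"
      by (rule sum.cong) auto
    moreover have "{x \<in> A. [f x = k] (mod int w)} = {x \<in> A. f x mod int w = k}"
      using k by (simp add: cong_def)
    ultimately show "(\<Sum>x | x \<in> A \<and> f x mod int w = k. z powi (f x mod int w)) =
        of_int (int (card {x \<in> A. [f x = k] (mod int w)})) * z powi k" by simp
  qed simp
  finally show ?thesis by (simp only: periodic_dft_def)
qed

text \<open>If a character sum over \<open>A\<close> is divisible by \<open>p ^ B\<close>, then so are the iterated differences of the
  fibre counts; these are too small to be nonzero multiples of \<open>p ^ B\<close>.\<close>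
lemma (in root_of_unity_character) character_sum_eq_0:
  assumes A: "A \<subseteq> carrier G" and Q: "set Q = prime_factors w" "Q \<noteq> []"
    and y: "y \<in> int_adjoin z" "(\<Sum>x\<in>A. char x) = of_nat (p ^ B) * y"
    and bound: "2 ^ (length Q - 1) * Coset.order G < w * p ^ B"
  shows "(\<Sum>x\<in>A. char x) = 0"
proof -
  have finA: "finite A" using A fin finite_subset by blast
  define F where "F k = int (card {x \<in> A. [f x = k] (mod int w)})" for k
  obtain h where h: "y = poly (of_int_poly h) z" using y(1) by (rule int_adjoinE)
  \<comment> \<open>\<open>H\<close> lists integer coordinates of y in the powers of z, extended
    periodically. They are not unique, but the transform of F - c * H vanishes at z, so the iterated
    differences of F and c * H agree.\<close>
  define H where "H k = fold_coeff w h (nat (k mod int w))" for k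
  define c where "c = int (p ^ B)"
  let ?T = "shift_diffs (map (\<lambda>q. int (w div q)) Q)"
  have F: "F (k + int w) = F k" for k by (simp add: F_def cong_def)
  have dftF: "periodic_dft w z F = (\<Sum>x\<in>A. char x)"
    unfolding F_def by (rule periodic_dft_fibre_card[OF finA])
  have "periodic_dft w z H = y"
    unfolding periodic_dft_nat H_def h sum_fold_coeff[OF z(1,2), symmetric] by (rule sum.cong) auto
  moreover have "periodic_dft w z (\<lambda>k. F k - c * H k) = periodic_dft w z F - of_int c * periodic_dft w z H"
    by (simp add: periodic_dft_def sum_subtractf sum_distrib_left algebra_simps)
  ultimately have "periodic_dft w z (\<lambda>k. F k - c * H k) = 0"
    using dftF y(2) by (simp add: c_def)
  moreover have "F (k + int w) - c * H (k + int w) = F k - c * H k" for k using F by (simp add: H_def)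
  ultimately have "?T (\<lambda>k. F k - c * H k) k = 0" for k by (intro shift_diffs_eq_0[OF z _ _ Q(1)])
  then have TF: "?T F k = c * ?T H k" for k by (simp add: shift_diffs_linear)
  define M where "M = Coset.order G div w"
  have M: "card {x \<in> carrier G. [f x = k] (mod int w)} = M" "M * w = Coset.order G" for k
  proof -
    have fibre: "card {x \<in> carrier G. [f x = k] (mod int w)} * w = Coset.order G" for k
      by (rule card_surj_hom_mod_fibre[OF fin hom z(2)])
    show "card {x \<in> carrier G. [f x = k] (mod int w)} = M"
      unfolding M_def fibre[of k, symmetric] using z(2) by simp
    with fibre[of k] show "M * w = Coset.order G" by simp
  qed
  have "0 \<le> F k \<and> F k \<le> int M" for k
  proof -
    have "card {x \<in> A. [f x = k] (mod int w)} \<le> card {x \<in> carrier G. [f x = k] (mod int w)}"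
      by (rule card_mono) (use A fin in auto)
    then show ?thesis by (simp add: F_def M(1))
  qed
  then have "\<bar>?T F k\<bar> \<le> 2 ^ (length Q - 1) * int M" for k
    using abs_shift_diffs_le[of F "int M" "map (\<lambda>q. int (w div q)) Q"] Q(2) by simp
  moreover have "2 ^ (length Q - 1) * int M < c"
  proof -
    have "w * (2 ^ (length Q - 1) * M) = 2 ^ (length Q - 1) * Coset.order G"
      unfolding M(2)[symmetric] by simp
    then have "w * (2 ^ (length Q - 1) * M) < w * p ^ B" using bound by (simp only:)
    then have "2 ^ (length Q - 1) * M < p ^ B" unfolding nat_mult_less_cancel_disj by blast
    then have "int (2 ^ (length Q - 1) * M) < int (p ^ B)" by (simp only: of_nat_less_iff)
    then show ?thesis unfolding c_def by (simp only: of_nat_mult of_nat_power of_nat_numeral)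
  qed
  ultimately have small: "\<bar>?T F k\<bar> < c" for k by (meson le_less_trans)
  have "?T F k = 0" for k
  proof (rule ccontr)
    assume "?T F k \<noteq> 0"
    then have "\<bar>c\<bar> \<le> \<bar>?T F k\<bar>" using TF by (intro dvd_imp_le_int) auto
    then show False using small[of k] by simp
  qed
  then have "periodic_dft w z (?T F) = 0" by (simp add: periodic_dft_def)
  then have "(\<Prod>s\<leftarrow>map (\<lambda>q. int (w div q)) Q. 1 - z powi s) * (\<Sum>x\<in>A. char x) = 0"
    by (simp only: periodic_dft_shift_diffs[where F = F, OF z(1,2) F] dftF)
  \<comment> \<open>Each w / q lies strictly between 0 and w, so its power of the primitive root z
    is not 1 and the factors can be cancelled.\<close>
  moreover have "(\<Prod>s\<leftarrow>map (\<lambda>q. int (w div q)) Q. 1 - z powi s) \<noteq> 0"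
  proof
    assume "(\<Prod>s\<leftarrow>map (\<lambda>q. int (w div q)) Q. 1 - z powi s) = 0"
    then obtain q where q: "q \<in> set Q" "z ^ (w div q) = 1" by (auto simp: prod_list_zero_iff)
    then have prime: "Factorial_Ring.prime q" and dvd: "q dvd w" using Q(1) by auto
    have "q \<le> w" using dvd z(2) by (rule dvd_imp_le)
    then have "0 < w div q" "w div q < w"
      using z(2) prime_gt_1_nat[OF prime] by (simp_all add: div_greater_zero_iff)
    then show False using inj_onD[OF z(3), of "w div q" 0] q(2) z(2) by simp
  qed
  ultimately show ?thesis by simp
qed

text \<open>\<open>B\<close> is an exponent for which p^B surely divides a character sum of norm p^N
  with N \<ge> e. In general this is half of e rounded down; if p does not divide the product of the
  \<open>q i\<close>, then N is even and rounding up is allowed.\<close>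

lemma no_SEDF_self_conjugate:
  assumes m: "m > 2" and t: "t \<ge> 1" "inj_on q {1..t}"
    and q: "\<And>i. i \<in> {1..t} \<Longrightarrow> Factorial_Ring.prime (q i) \<and> q i dvd v"
    and p: "Factorial_Ring.prime p" "self_conjugate_modulo p (\<Prod>i=1..t. q i)"
    and B: "B \<le> e div 2 \<or> \<not> p dvd (\<Prod>i=1..t. q i) \<and> B \<le> (e + 1) div 2"
    and bound: "2 ^ (t - 1) * v < (\<Prod>i=1..t. q i) * p ^ B"
  shows "\<not> is_SEDF G v m k (p ^ e) D"
proof
  assume D: "is_SEDF G v m k (p ^ e) D"
  then interpret comm_group G by (simp add: is_SEDF_def)
  have fin: "finite (carrier G)" and ord: "Coset.order G = v" using D by (simp_all add: is_SEDF_def)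
  define w where "w = (\<Prod>i=1..t. q i)"
  have w0: "w > 0" unfolding w_def using q prime_gt_0_nat by (auto intro!: prod_pos)
  have prime_dvd: "\<exists>i\<in>{1..t}. r = q i" if "Factorial_Ring.prime r" "r dvd w" for r
    using that q unfolding w_def by (metis finite_atLeastAtMost prime_dvd_prod_iff primes_dvd_imp_eq)
  have q_dvd: "q i dvd w" if "i \<in> {1..t}" for i unfolding w_def using that by (intro dvd_prodI) auto
  have w1: "w > 1"
  proof -
    have "q 1 dvd w" "q 1 > 1" using q_dvd q[of 1] t(1) prime_gt_1_nat by auto
    then show ?thesis using w0 by (meson dvd_imp_le less_le_trans)
  qed
  have "squarefree w" unfolding w_def
  proof (rule squarefree_prod_coprime)
    fix i j assume ij: "i \<in> {1..t}" "j \<in> {1..t}" "i \<noteq> j"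
    then have "q i \<noteq> q j" using t(2) by (auto dest: inj_onD)
    then show "coprime (q i) (q j)" using q ij by (intro primes_coprime) auto
  qed (use q squarefree_prime in blast)
  then have p2: "\<not> p ^ 2 dvd w" using p(1) squarefreeD[of w p] not_prime_unit by blast
  obtain f where hom: "surj_hom_mod G (int w) f"
    unfolding w_def using exists_surj_hom_mod[OF fin _ t(2)] q ord by auto
  define z where "z = cis (2 * pi / real w)"
  have z: "z ^ w = 1" "inj_on (\<lambda>k. z ^ k) {..<w}"
    unfolding z_def by (rule primitive_root_of_unity[OF w0])+
  interpret root_of_unity_character G w f z by unfold_locales (use fin hom z w0 in auto)
  define X where "X l = (\<Sum>x\<in>D l. char x)" for l
  have X_in: "X l \<in> int_adjoin z" for l unfolding X_def using char_in_int_adjoin by auto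
  have "(\<Sum>l\<in>{1..m} - {j}. X l) * cnj (X j) = - of_nat (p ^ e)" if "j \<in> {1..m}" for j
    unfolding X_def by (rule SEDF_character_equation[OF D that w1])
  then obtain i j where ij: "i \<in> {1..m}" "j \<in> {1..m}" "(cmod (X i))\<^sup>2 \<in> \<rat>" "(cmod (X j))\<^sup>2 \<in> \<rat>"
    and prod: "(cmod (X i))\<^sup>2 * (cmod (X j))\<^sup>2 = (real (p ^ e))\<^sup>2" and ge: "(cmod (X j))\<^sup>2 \<ge> real (p ^ e)"
    using character_norms_rational[OF m, of "p ^ e" X] p(1) prime_gt_0_nat by (metis zero_less_power)
  obtain ni nj :: nat where n: "(cmod (X i))\<^sup>2 = real ni" "(cmod (X j))\<^sup>2 = real nj"
    using int_adjoin_rational_norm[OF z(1) w0 X_in] ij by metis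
  have "real (ni * nj) = real ((p ^ e)\<^sup>2)" using prod n by simp
  \<comment> \<open>The two squared norms are integers with product p^(2*e), so the one that is at
    least p^e is itself a power p^N, with N \<ge> e.\<close>
  then have "ni * nj = (p ^ e)\<^sup>2" by (simp only: of_nat_eq_iff)
  then have "nj dvd p ^ (e * 2)" unfolding power_mult by (metis dvd_triv_right)
  then obtain N where N: "nj = p ^ N" using p(1) by (auto simp: divides_primepow_nat)
  have "p ^ e \<le> p ^ N" using ge n N by (metis of_nat_le_iff)
  then have eN: "e \<le> N" using prime_gt_1_nat[OF p(1)] by simp
  have norm: "X j * cnj (X j) = of_nat p ^ N"
    using complex_norm_square[of "X j"] n(2) N by (metis of_nat_power of_real_of_nat_eq)
  obtain y where y: "y \<in> int_adjoin z" "X j = of_nat p ^ (N div 2) * y"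
    using self_conjugate_norm_power(1)[OF z p(1) p(2)[folded w_def] p2 X_in norm] by blast
  have "B \<le> N div 2"
  proof (cases "B \<le> e div 2")
    case True
    then show ?thesis using eN by (meson div_le_mono le_trans)
  next
    case False
    then have "even N" "B \<le> (e + 1) div 2"
      using B self_conjugate_norm_power(2)[OF z p(1) p(2)[folded w_def] p2 X_in norm]
      unfolding w_def by auto
    then show ?thesis using eN by (auto elim!: evenE)
  qed
  then have "X j = of_nat (p ^ B) * (of_nat p ^ (N div 2 - B) * y)"
    using y(2) by (simp add: mult.assoc[symmetric] flip: power_add)
  moreover have "of_nat p ^ (N div 2 - B) * y \<in> int_adjoin z" using y(1) by auto
  moreover have "D j \<subseteq> carrier G" using D ij(2) by (simp add: is_SEDF_def)
  moreover have "set (map q [1..<Suc t]) = prime_factors w"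
  proof -
    have "set (map q [1..<Suc t]) = q ` {1..t}" by (simp add: atLeastLessThanSuc_atLeastAtMost del: upt_Suc)
    also have "\<dots> = prime_factors w"
    proof
      show "q ` {1..t} \<subseteq> prime_factors w" using q q_dvd w0 by (auto simp: prime_factors_dvd)
      show "prime_factors w \<subseteq> q ` {1..t}"
        using prime_dvd w0 unfolding prime_factors_dvd by blast
    qed
    finally show ?thesis .
  qed
  moreover have "length (map q [1..<Suc t]) = t" by simp
  ultimately have "X j = 0"
    unfolding X_def using bound[folded w_def] t(1) ord
    by (intro character_sum_eq_0[where Q = "map q [1..<Suc t]"]) auto
  then show False using norm p(1) by simp
qed

section \<open>The numerical conditions of the three cases\<close>

lemma real_bound_imp_nat_bound:
  fixes p a b \<delta> m t w C :: nat
  assumes p: "p > 0" and m: "m > 0"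
    and bound: "real w > 2 ^ (t - 1) *
      ((real m - 1) * real p powi (2 * int a - int b) * real C + real p powi (- int b))"
  shows "2 ^ (t - 1) * ((m - 1) * p ^ (2 * a + \<delta>) * C + 1) < w * p ^ (b + \<delta>)"
proof -
  have powi: "real p powi (2 * int a - int b) * real p ^ b = real p ^ (2 * a)" "real p powi (- int b) * real p ^ b = 1"
  proof -
    have "real p powi (2 * int a - int b) * real p powi int b = real p powi int (2 * a)"
      using p by (subst power_int_add[symmetric]) auto
    then show "real p powi (2 * int a - int b) * real p ^ b = real p ^ (2 * a)" by (simp only: power_int_of_nat)
    show "real p powi (- int b) * real p ^ b = 1" using p by (simp add: power_int_minus)
  qed
  have "2 ^ (t - 1) * ((real m - 1) * real p powi (2 * int a - int b) * real C + real p powi (- int b)) * real p ^ (b + \<delta>)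
      = 2 ^ (t - 1) * ((real m - 1) * (real p powi (2 * int a - int b) * real p ^ b) * real C
          + real p powi (- int b) * real p ^ b) * real p ^ \<delta>"
    by (simp add: power_add algebra_simps)
  also have "\<dots> = 2 ^ (t - 1) * ((real m - 1) * real p ^ (2 * a + \<delta>) * real C + real p ^ \<delta>)"
    unfolding powi by (simp add: power_add algebra_simps)
  finally have eq: "2 ^ (t - 1) * ((real m - 1) * real p powi (2 * int a - int b) * real C + real p powi (- int b))
      * real p ^ (b + \<delta>) = \<dots>" .
  have "0 < real p ^ (b + \<delta>)" using p by simp
  note less = mult_strict_right_mono[OF bound this, unfolded eq]
  \<comment> \<open>Multiplying the bound by p^(b+\<delta>) clears the negative exponents and turns
    the last summand into p^\<delta>, which is at least the 1 in the group order.\<close>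
  have "2 ^ (t - 1) * ((real m - 1) * real p ^ (2 * a + \<delta>) * real C + 1)
      \<le> 2 ^ (t - 1) * ((real m - 1) * real p ^ (2 * a + \<delta>) * real C + real p ^ \<delta>)"
    using p by (intro mult_left_mono add_left_mono) auto
  note le_less_trans[OF this less]
  moreover have "real (2 ^ (t - 1) * ((m - 1) * p ^ (2 * a + \<delta>) * C + 1)) =
      2 ^ (t - 1) * ((real m - 1) * real p ^ (2 * a + \<delta>) * real C + 1)"
    using m by (simp add: of_nat_diff distrib_left)
  moreover have "real (w * p ^ (b + \<delta>)) = real w * real p ^ (b + \<delta>)" by simp
  ultimately have "real (2 ^ (t - 1) * ((m - 1) * p ^ (2 * a + \<delta>) * C + 1)) < real (w * p ^ (b + \<delta>))"
    by (simp only:)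
  then show ?thesis by (simp only: of_nat_less_iff)
qed

text \<open>Consecutive integers are coprime. In the first two cases p1 divides v - 1, so the
  stronger rounding of the exponent is available.\<close>

lemma prime_not_dvd_prod_of_coprime_divisors:
  fixes p v :: nat
  assumes p: "Factorial_Ring.prime p" and v: "p dvd v - 1" "v > 0"
    and q: "finite I" "\<And>i. i \<in> I \<Longrightarrow> q i dvd v"
  shows "\<not> p dvd (\<Prod>i\<in>I. q i)"
proof
  assume "p dvd (\<Prod>i\<in>I. q i)"
  then obtain i where "i \<in> I" "p dvd q i" using p q(1) by (auto simp: prime_dvd_prod_iff)
  then have "p dvd v" using q(2) dvd_trans by blast
  then have "p dvd v - (v - 1)" using v(1) by (rule dvd_diff_nat)
  then show False using v(2) p by simp
qed

theorem theorem3p18: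
  fixes G :: "('g, 'h) monoid_scheme"
    and p1 p2 \<delta> m a b c :: nat
  assumes "comm_group G" and "finite (carrier G)"
    and "Factorial_Ring.prime p1" and "Factorial_Ring.prime p2" and "p1 \<noteq> p2"
    and "\<delta> \<in> {0, 1}"
    and "m > 2" and "a > 0" and "b > 0" and "c > 0"
  shows
    "(\<forall>(t::nat) (q :: nat \<Rightarrow> nat).
        t \<ge> 1 \<and> inj_on q {1..t} \<and>
        (\<forall>i\<in>{1..t}. Factorial_Ring.prime (q i) \<and> q i dvd (m - 1) * p1 ^ (2 * a + \<delta>) + 1) \<and>
        self_conjugate_modulo p1 (\<Prod>i=1..t. q i) \<and>
        real (\<Prod>i=1..t. q i) >
          2 ^ (t - 1) * ((real m - 1) * real p1 powi (2 * int a - int b) + real p1 powi (- int b))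
        \<longrightarrow> \<not> (\<exists>D. is_SEDF G ((m - 1) * p1 ^ (2 * a + \<delta>) + 1) m
                   (p1 ^ (a + b + \<delta>)) (p1 ^ (2 * b + \<delta>)) D))
     \<and>
     (\<forall>(t::nat) (q :: nat \<Rightarrow> nat).
        t \<ge> 1 \<and> inj_on q {1..t} \<and>
        (\<forall>i\<in>{1..t}. Factorial_Ring.prime (q i) \<and>
           q i dvd (m - 1) * p1 ^ (2 * a + \<delta>) * p2 ^ (2 * c) + 1) \<and>
        self_conjugate_modulo p1 (\<Prod>i=1..t. q i) \<and>
        real (\<Prod>i=1..t. q i) >
          2 ^ (t - 1) * ((real m - 1) * real p1 powi (2 * int a - int b) * real p2 ^ (2 * c)
                         + real p1 powi (- int b))
        \<longrightarrow> \<not> (\<exists>D. is_SEDF G ((m - 1) * p1 ^ (2 * a + \<delta>) * p2 ^ (2 * c) + 1) m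
                   (p1 ^ (a + b + \<delta>) * p2 ^ c) (p1 ^ (2 * b + \<delta>)) D))
     \<and>
     (\<forall>(t::nat) (q :: nat \<Rightarrow> nat).
        t \<ge> 1 \<and> inj_on q {1..t} \<and>
        (\<forall>i\<in>{1..t}. Factorial_Ring.prime (q i) \<and> q i dvd (m - 1) * p1 ^ (2 * a) + 1) \<and>
        self_conjugate_modulo p2 (\<Prod>i=1..t. q i) \<and>
        (\<Prod>i=1..t. q i) * p2 ^ b > 2 ^ (t - 1) * ((m - 1) * p1 ^ (2 * a) + 1)
        \<longrightarrow> \<not> (\<exists>D. is_SEDF G ((m - 1) * p1 ^ (2 * a) + 1) m
                   (p1 ^ a * p2 ^ b) (p2 ^ (2 * b)) D))"
proof (intro conjI allI impI; elim conjE)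
  have p0: "p1 > 0" using assms(3) prime_gt_0_nat by blast
  \<comment> \<open>For \<delta> in {0, 1}, b + \<delta> is half of 2 * b + \<delta> rounded up.
    Rounding down would lose a factor p1 when \<delta> = 1.\<close>
  have half: "b + \<delta> \<le> (2 * b + \<delta> + 1) div 2" using assms(6) by auto
  \<comment> \<open>The first two claims are treated together: \<open>C\<close> is 1 in the first
    and p2^(2*c) in the second.\<close>
  {
    fix C t :: nat and q :: "nat \<Rightarrow> nat"
    let ?v = "(m - 1) * p1 ^ (2 * a + \<delta>) * C + 1"
    assume t: "t \<ge> 1" "inj_on q {1..t}"
      and q: "\<forall>i\<in>{1..t}. Factorial_Ring.prime (q i) \<and> q i dvd ?v"
      and sc: "self_conjugate_modulo p1 (\<Prod>i=1..t. q i)"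
      and bound: "real (\<Prod>i=1..t. q i) > 2 ^ (t - 1) *
        ((real m - 1) * real p1 powi (2 * int a - int b) * real C + real p1 powi (- int b))"
    have "p1 dvd ?v - 1" using assms(8) by simp
    then have "\<not> p1 dvd (\<Prod>i=1..t. q i)"
      using q by (intro prime_not_dvd_prod_of_coprime_divisors[OF assms(3), of ?v]) auto
    then have "\<not> is_SEDF G ?v m k (p1 ^ (2 * b + \<delta>)) D" for k D
      using no_SEDF_self_conjugate[OF assms(7) t _ assms(3) sc, of ?v "b + \<delta>" "2 * b + \<delta>" G k D] q half
        real_bound_imp_nat_bound[OF p0 _ bound, of \<delta>] assms(7) by auto
  }
  note case12 = this
  {
    fix t :: nat and q :: "nat \<Rightarrow> nat"
    assume "t \<ge> 1" "inj_on q {1..t}"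
      "\<forall>i\<in>{1..t}. Factorial_Ring.prime (q i) \<and> q i dvd (m - 1) * p1 ^ (2 * a + \<delta>) + 1"
      "self_conjugate_modulo p1 (\<Prod>i=1..t. q i)"
      "real (\<Prod>i=1..t. q i) >
          2 ^ (t - 1) * ((real m - 1) * real p1 powi (2 * int a - int b) + real p1 powi (- int b))"
    then show "\<not> (\<exists>D. is_SEDF G ((m - 1) * p1 ^ (2 * a + \<delta>) + 1) m
                   (p1 ^ (a + b + \<delta>)) (p1 ^ (2 * b + \<delta>)) D)"
      using case12[of t q 1] by simp
  next
    fix t :: nat and q :: "nat \<Rightarrow> nat"
    assume "t \<ge> 1" "inj_on q {1..t}"
      "\<forall>i\<in>{1..t}. Factorial_Ring.prime (q i) \<and>
           q i dvd (m - 1) * p1 ^ (2 * a + \<delta>) * p2 ^ (2 * c) + 1"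
      "self_conjugate_modulo p1 (\<Prod>i=1..t. q i)"
      "real (\<Prod>i=1..t. q i) >
          2 ^ (t - 1) * ((real m - 1) * real p1 powi (2 * int a - int b) * real p2 ^ (2 * c)
                         + real p1 powi (- int b))"
    then show "\<not> (\<exists>D. is_SEDF G ((m - 1) * p1 ^ (2 * a + \<delta>) * p2 ^ (2 * c) + 1) m
                   (p1 ^ (a + b + \<delta>) * p2 ^ c) (p1 ^ (2 * b + \<delta>)) D)"
      using case12[of t q "p2 ^ (2 * c)"] by simp
  next
    fix t :: nat and q :: "nat \<Rightarrow> nat"
    assume "t \<ge> 1" "inj_on q {1..t}"
      "\<forall>i\<in>{1..t}. Factorial_Ring.prime (q i) \<and> q i dvd (m - 1) * p1 ^ (2 * a) + 1"
      "self_conjugate_modulo p2 (\<Prod>i=1..t. q i)"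
      "(\<Prod>i=1..t. q i) * p2 ^ b > 2 ^ (t - 1) * ((m - 1) * p1 ^ (2 * a) + 1)"
    then show "\<not> (\<exists>D. is_SEDF G ((m - 1) * p1 ^ (2 * a) + 1) m
                   (p1 ^ a * p2 ^ b) (p2 ^ (2 * b)) D)"
      \<comment> \<open>Here p2 may divide the product of the \<open>q i\<close>, but the exponent 2
        * b is even, so rounding down already gives B = b.\<close>
      using no_SEDF_self_conjugate[OF assms(7), of t q _ p2 b "2 * b" G] assms(4) by auto
  }
qed

end
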